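(* Let $\varphi\in O_M$ be a symbol for $S(\mathbb{R})$ such that the multiplication operator $M_{\varphi'}:S(\mathbb{R})\to S(\mathbb{R})$, $f\mapsto \varphi' f$, has closed range. Then $C_{\varphi}:S(\mathbb{R})\to S(\mathbb{R})$, $f\mapsto f\circ\varphi$, also has closed range.
   Context: All functions are real-valued. $S(\mathbb{R})$ is the (real) Schwartz space of smooth functions $f:\mathbb{R}\to\mathbb{R}$ such that $\pi_n(f):=\sup_{x\in \mathbb{R}}\sup_{0\leq j\leq n}(1+|x|^2)^n|f^{(j)}(x)|<\infty$ for each $n\in\mathbb{N}$, endowed with the Fréchet topology generated by $(\pi_n)_{n}$. A function $\varphi\in C^\infty(\mathbb{R})$ is called a symbol for $S(\mathbb{R})$ if $f\circ\varphi\in S(\mathbb{R})$ whenever $f\in S(\mathbb{R})$. $O_M$ is the space of multipliers of $S(\mathbb{R})$, i.e. the smooth functions $F:\mathbb{R}\to\mathbb{R}$ with $F\cdot S(\mathbb{R})\subset S(\mathbb{R})$; equivalently, for each $k\in\mathbb{N}_0$ there exist $C>0$ and $j\in\mathbb{N}$ such that $|F^{(k)}(x)|\leq C(1+x^2)^j$ for all $x\in\mathbb{R}$. If $\varphi\in O_M$ then $\varphi'\in O_M$. An operator has closed range if its image is a closed subset of the target space. *)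

theory Defs
  imports "HOL-Analysis.Analysis"
begin

definition smooth :: "(real \<Rightarrow> real) \<Rightarrow> bool" where
  "smooth f \<longleftrightarrow> (\<forall>k x. (deriv ^^ k) f field_differentiable at x)"

(* Extended-real valued, so that the supremum is meaningful for every f. *)
definition schwartz_seminorm :: "nat \<Rightarrow> (real \<Rightarrow> real) \<Rightarrow> ereal" where
  "schwartz_seminorm n f =
     (SUP x. SUP j\<in>{0..n}. ereal ((1 + \<bar>x\<bar>\<^sup>2) ^ n * \<bar>(deriv ^^ j) f x\<bar>))"

definition schwartz_space :: "(real \<Rightarrow> real) set" where
  "schwartz_space = {f. smooth f \<and> (\<forall>n. schwartz_seminorm n f < \<infinity>)}"

definition schwartz_ball :: "nat \<Rightarrow> (real \<Rightarrow> real) \<Rightarrow> real \<Rightarrow> (real \<Rightarrow> real) set" where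
  "schwartz_ball n f e =
     {g \<in> schwartz_space. schwartz_seminorm n (\<lambda>x. g x - f x) < ereal e}"

(* The seminorm balls are used as a subbase. *)
definition schwartz_topology :: "(real \<Rightarrow> real) topology" where
  "schwartz_topology =
     topology_generated_by {schwartz_ball n f e | n f e. f \<in> schwartz_space \<and> e > 0}"

definition schwartz_multipliers :: "(real \<Rightarrow> real) set" where
  "schwartz_multipliers =
     {F. smooth F \<and> (\<forall>f\<in>schwartz_space. (\<lambda>x. F x * f x) \<in> schwartz_space)}"

definition schwartz_symbol :: "(real \<Rightarrow> real) \<Rightarrow> bool" where
  "schwartz_symbol \<phi> \<longleftrightarrow>
     smooth \<phi> \<and> (\<forall>f\<in>schwartz_space. f \<circ> \<phi> \<in> schwartz_space)"

definition mult_operator :: "(real \<Rightarrow> real) \<Rightarrow> (real \<Rightarrow> real) \<Rightarrow> (real \<Rightarrow> real)" where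
  "mult_operator F f = (\<lambda>x. F x * f x)"

definition comp_operator :: "(real \<Rightarrow> real) \<Rightarrow> (real \<Rightarrow> real) \<Rightarrow> (real \<Rightarrow> real)" where
  "comp_operator \<phi> f = f \<circ> \<phi>"

(* Operators on the Schwartz space are total functions; only their values on
   schwartz_space are relevant. *)
definition has_closed_range :: "((real \<Rightarrow> real) \<Rightarrow> (real \<Rightarrow> real)) \<Rightarrow> bool" where
  "has_closed_range T \<longleftrightarrow> closedin schwartz_topology (T ` schwartz_space)"

lemma deriv_funpow_zero: "(deriv ^^ k) (\<lambda>x. 0 :: real) = (\<lambda>x. 0)"
  by (induction k) auto

lemma schwartz_seminorm_zero: "schwartz_seminorm n (\<lambda>x. 0) = 0"
  by (simp add: schwartz_seminorm_def deriv_funpow_zero flip: zero_ereal_def)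

lemma topspace_schwartz_topology [simp]: "topspace schwartz_topology = schwartz_space"
proof -
  have "f \<in> schwartz_ball 0 f 1" if "f \<in> schwartz_space" for f
    using that by (simp add: schwartz_ball_def schwartz_seminorm_zero)
  moreover have "schwartz_ball n f e \<subseteq> schwartz_space" for n f e
    by (auto simp: schwartz_ball_def)
  ultimately show ?thesis
    unfolding schwartz_topology_def topology_generated_by_topspace
    by (fastforce intro: zero_less_one)
qed

end

theory Submission
  imports Defs
begin

text \<open>Uniform boundedness on the (complete) range of multiplication by \<open>\<phi>'\<close> yields continuous
  dependence of \<open>f\<close> on \<open>\<phi>' f\<close>, off the zeros of \<open>\<phi>'\<close>. As \<open>(f \<circ> \<phi>)' = \<phi>' (f' \<circ> \<phi>)\<close>, iteration
  controls all \<open>(deriv ^^ k) f \<circ> \<phi>\<close>, with polynomial weights in \<open>\<phi>\<close>, by seminorms of \<open>f \<circ> \<phi>\<close>; the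
  images of noncritical points being dense in the range of \<open>\<phi>\<close>, these bounds hold on its closure
  \<open>I\<close>. If \<open>f_n \<circ> \<phi>\<close> converges, then the derivatives of \<open>f_n\<close> therefore converge on \<open>I\<close>. Being closed,
  unbounded and connected, \<open>I\<close> is the line or a half-line, and in the latter case the limit is
  extended across the endpoint by Borel's lemma.\<close>

section \<open>Smooth functions and the Schwartz seminorms\<close>

lemma smooth_has_derivative:
  "smooth f \<Longrightarrow> ((deriv ^^ k) f has_field_derivative (deriv ^^ Suc k) f x) (at x)"
  unfolding smooth_def by (simp add: field_differentiable_derivI)

lemma higher_deriv_jet:
  fixes v :: "nat \<Rightarrow> real \<Rightarrow> real"
  assumes "\<And>k x. (v k has_field_derivative v (Suc k) x) (at x)"
  shows "(deriv ^^ k) (v 0) = v k"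
proof (induction k)
  case (Suc k)
  show ?case
    using DERIV_imp_deriv[OF assms, of k] by (simp add: Suc fun_eq_iff)
qed simp

lemma smooth_jet:
  fixes v :: "nat \<Rightarrow> real \<Rightarrow> real"
  assumes "\<And>k x. (v k has_field_derivative v (Suc k) x) (at x)"
  shows "smooth (v 0)"
  unfolding smooth_def higher_deriv_jet[of v, OF assms]
  using assms field_differentiable_def by blast

lemma smooth_continuous: "smooth f \<Longrightarrow> continuous_on A ((deriv ^^ k) f)"
  by (meson DERIV_isCont continuous_at_imp_continuous_on smooth_has_derivative)

lemma smooth_higher_deriv: "smooth f \<Longrightarrow> smooth ((deriv ^^ k) f)"
  unfolding smooth_def by (metis comp_apply funpow_add)

lemma smooth_deriv: "smooth f \<Longrightarrow> smooth (deriv f)"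
  using smooth_higher_deriv[of f 1] by simp

lemma
  assumes "smooth f" "smooth g"
  shows smooth_add: "smooth (\<lambda>x. f x + g x)"
    and higher_deriv_add: "(deriv ^^ k) (\<lambda>x. f x + g x) = (\<lambda>x. (deriv ^^ k) f x + (deriv ^^ k) g x)"
proof -
  let ?v = "\<lambda>k x. (deriv ^^ k) f x + (deriv ^^ k) g x"
  have v: "(?v k has_field_derivative ?v (Suc k) x) (at x)" for k x
    by (intro DERIV_add smooth_has_derivative assms)
  show "smooth (\<lambda>x. f x + g x)" using smooth_jet[of ?v, OF v] by simp
  show "(deriv ^^ k) (\<lambda>x. f x + g x) = ?v k" using higher_deriv_jet[of ?v, OF v] by simp
qed

lemma
  assumes "smooth f"
  shows smooth_cmult: "smooth (\<lambda>x. c * f x)"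
    and higher_deriv_cmult: "(deriv ^^ k) (\<lambda>x. c * f x) = (\<lambda>x. c * (deriv ^^ k) f x)"
proof -
  let ?v = "\<lambda>k x. c * (deriv ^^ k) f x"
  have v: "(?v k has_field_derivative ?v (Suc k) x) (at x)" for k x
    by (intro DERIV_cmult smooth_has_derivative assms)
  show "smooth (\<lambda>x. c * f x)" using smooth_jet[of ?v, OF v] by simp
  show "(deriv ^^ k) (\<lambda>x. c * f x) = ?v k" using higher_deriv_jet[of ?v, OF v] by simp
qed

lemma higher_deriv_diff:
  assumes "smooth f" "smooth g"
  shows "(deriv ^^ k) (\<lambda>x. f x - g x) = (\<lambda>x. (deriv ^^ k) f x - (deriv ^^ k) g x)"
  using higher_deriv_add[OF assms(1) smooth_cmult[OF assms(2), of "-1"]]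
    higher_deriv_cmult[OF assms(2), of _ "-1"] by simp_all

lemma
  assumes "smooth f"
  shows smooth_affine: "smooth (\<lambda>x. f (s * x + c))"
    and higher_deriv_affine:
      "(deriv ^^ k) (\<lambda>x. f (s * x + c)) = (\<lambda>x. s ^ k * (deriv ^^ k) f (s * x + c))"
proof -
  let ?v = "\<lambda>k x. s ^ k * (deriv ^^ k) f (s * x + c)"
  have v: "(?v k has_field_derivative ?v (Suc k) x) (at x)" for k x
    by (rule derivative_eq_intros DERIV_chain2[OF smooth_has_derivative[OF assms]] refl)+ simp
  show "smooth (\<lambda>x. f (s * x + c))" using smooth_jet[of ?v, OF v] by simp
  show "(deriv ^^ k) (\<lambda>x. f (s * x + c)) = ?v k" using higher_deriv_jet[of ?v, OF v] by simp
qed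

lemma higher_deriv_mult:
  assumes "smooth f" "smooth g"
  shows "(deriv ^^ k) (\<lambda>x. f x * g x) =
    (\<lambda>x. \<Sum>i\<le>k. of_nat (k choose i) * ((deriv ^^ i) f x * (deriv ^^ (k - i)) g x))"
proof -
  let ?v = "\<lambda>k x. \<Sum>i\<le>k. of_nat (k choose i) * ((deriv ^^ i) f x * (deriv ^^ (k - i)) g x)"
  have "(?v k has_field_derivative ?v (Suc k) x) (at x)" for k x
  proof -
    let ?a = "\<lambda>i. (deriv ^^ i) f x" and ?b = "\<lambda>i. (deriv ^^ i) g x"
    have "(?v k has_field_derivative
        (\<Sum>i\<le>k. of_nat (k choose i) * (?a (Suc i) * ?b (k - i) + ?b (Suc (k - i)) * ?a i))) (at x)"
      by (intro DERIV_sum DERIV_cmult DERIV_mult smooth_has_derivative assms)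
    moreover have "(\<Sum>i\<le>k. of_nat (k choose i) * (?a (Suc i) * ?b (k - i) + ?b (Suc (k - i)) * ?a i)) =
        ?v (Suc k) x"
    proof -
      have "?v (Suc k) x = ?b (Suc k) * ?a 0
          + (\<Sum>i\<le>k. of_nat (Suc k choose Suc i) * (?a (Suc i) * ?b (k - i)))"
        by (subst sum.atMost_Suc_shift) simp
      also have "\<dots> = ?b (Suc k) * ?a 0 + (\<Sum>i\<le>k. of_nat (k choose Suc i) * (?a (Suc i) * ?b (k - i)))
          + (\<Sum>i\<le>k. of_nat (k choose i) * (?a (Suc i) * ?b (k - i)))"
        by (simp add: algebra_simps flip: sum.distrib)
      also have "?b (Suc k) * ?a 0 + (\<Sum>i\<le>k. of_nat (k choose Suc i) * (?a (Suc i) * ?b (k - i))) =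
          (\<Sum>i\<le>Suc k. of_nat (k choose i) * (?a i * ?b (Suc k - i)))"
        by (subst sum.atMost_Suc_shift) simp
      also have "\<dots> = (\<Sum>i\<le>k. of_nat (k choose i) * (?b (Suc (k - i)) * ?a i))"
        by (simp add: Suc_diff_le mult.commute)
      finally show ?thesis by (simp add: algebra_simps sum.distrib)
    qed
    ultimately show ?thesis by simp
  qed
  from higher_deriv_jet[of ?v, OF this] show ?thesis by simp
qed

lemma higher_deriv_cong_open:
  fixes f g :: "real \<Rightarrow> real"
  assumes "open U" "\<And>x. x \<in> U \<Longrightarrow> f x = g x" "x \<in> U"
  shows "(deriv ^^ k) f x = (deriv ^^ k) g x"
  using assms(3)
proof (induction k arbitrary: x)
  case (Suc k)
  have "eventually (\<lambda>y. y \<in> U) (nhds x)"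
    using Suc.prems assms(1) by (simp add: eventually_nhds_in_open)
  then have "eventually (\<lambda>y. (deriv ^^ k) f y = (deriv ^^ k) g y) (nhds x)"
    by eventually_elim (rule Suc.IH)
  then show ?case by (simp add: deriv_cong_ev)
qed (simp add: assms(2))

definition seminorm_real :: "nat \<Rightarrow> (real \<Rightarrow> real) \<Rightarrow> real" where
  "seminorm_real n f = real_of_ereal (schwartz_seminorm n f)"

lemma schwartz_seminorm_le_iff:
  "schwartz_seminorm n f \<le> ereal B \<longleftrightarrow> (\<forall>x. \<forall>j\<le>n. (1 + x\<^sup>2) ^ n * \<bar>(deriv ^^ j) f x\<bar> \<le> B)"
  by (auto simp: schwartz_seminorm_def SUP_le_iff)

lemma schwartz_seminorm_nonneg: "0 \<le> schwartz_seminorm n f"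
proof -
  have "0 \<le> ereal ((1 + \<bar>0\<bar>\<^sup>2) ^ n * \<bar>(deriv ^^ 0) f 0\<bar>)" by simp
  also have "\<dots> \<le> schwartz_seminorm n f"
    unfolding schwartz_seminorm_def by (rule SUP_upper2[of 0], simp, rule SUP_upper) simp
  finally show ?thesis .
qed

lemma seminorm_real_nonneg: "0 \<le> seminorm_real n f"
  by (simp add: seminorm_real_def real_of_ereal_pos schwartz_seminorm_nonneg)

lemma schwartz_seminorm_finite_iff:
  "schwartz_seminorm n f < \<infinity> \<longleftrightarrow> (\<exists>B. \<forall>x. \<forall>j\<le>n. (1 + x\<^sup>2) ^ n * \<bar>(deriv ^^ j) f x\<bar> \<le> B)"
  unfolding schwartz_seminorm_le_iff[symmetric]
  using schwartz_seminorm_nonneg[of n f]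
  by (cases "schwartz_seminorm n f") auto

lemma schwartz_space_iff:
  "f \<in> schwartz_space \<longleftrightarrow>
     smooth f \<and> (\<forall>n. \<exists>B. \<forall>x. \<forall>j\<le>n. (1 + x\<^sup>2) ^ n * \<bar>(deriv ^^ j) f x\<bar> \<le> B)"
  by (simp only: schwartz_space_def mem_Collect_eq schwartz_seminorm_finite_iff)

lemma schwartz_smooth: "f \<in> schwartz_space \<Longrightarrow> smooth f"
  by (simp add: schwartz_space_def)

lemma schwartz_seminorm_eq:
  "f \<in> schwartz_space \<Longrightarrow> schwartz_seminorm n f = ereal (seminorm_real n f)"
  using schwartz_seminorm_nonneg[of n f]
  by (cases "schwartz_seminorm n f") (auto simp: schwartz_space_def seminorm_real_def)

lemma seminorm_real_upper:
  assumes "f \<in> schwartz_space" "j \<le> n"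
  shows "(1 + x\<^sup>2) ^ n * \<bar>(deriv ^^ j) f x\<bar> \<le> seminorm_real n f"
  using schwartz_seminorm_le_iff[of n f "seminorm_real n f"] schwartz_seminorm_eq[OF assms(1)] assms(2)
  by auto

lemma one_le_weight: "(1::real) \<le> (1 + x\<^sup>2) ^ n"
  by (rule one_le_power) simp

lemma seminorm_real_abs:
  assumes "f \<in> schwartz_space" "j \<le> n"
  shows "\<bar>(deriv ^^ j) f x\<bar> \<le> seminorm_real n f"
  by (rule order_trans[OF _ seminorm_real_upper[OF assms]])
    (use mult_right_mono[OF one_le_weight, of "\<bar>(deriv ^^ j) f x\<bar>"] in simp)

lemma seminorm_real_least:
  assumes "\<And>x j. j \<le> n \<Longrightarrow> (1 + x\<^sup>2) ^ n * \<bar>(deriv ^^ j) f x\<bar> \<le> B"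
  shows "seminorm_real n f \<le> B"
proof -
  have "schwartz_seminorm n f \<le> ereal B" using assms by (simp add: schwartz_seminorm_le_iff)
  then show ?thesis using schwartz_seminorm_nonneg[of n f]
    by (cases "schwartz_seminorm n f") (auto simp: seminorm_real_def)
qed

lemma seminorm_real_mono:
  assumes "f \<in> schwartz_space" "n \<le> m"
  shows "seminorm_real n f \<le> seminorm_real m f"
proof (rule seminorm_real_least)
  fix x j assume "j \<le> n"
  have "(1 + x\<^sup>2) ^ n * \<bar>(deriv ^^ j) f x\<bar> \<le> (1 + x\<^sup>2) ^ m * \<bar>(deriv ^^ j) f x\<bar>"
    by (intro mult_right_mono power_increasing assms) auto
  also have "\<dots> \<le> seminorm_real m f" using seminorm_real_upper assms \<open>j \<le> n\<close> by auto
  finally show "(1 + x\<^sup>2) ^ n * \<bar>(deriv ^^ j) f x\<bar> \<le> seminorm_real m f" .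
qed

lemma
  assumes "f \<in> schwartz_space" "g \<in> schwartz_space"
  shows schwartz_add: "(\<lambda>x. f x + g x) \<in> schwartz_space"
    and seminorm_real_add:
      "seminorm_real n (\<lambda>x. f x + g x) \<le> seminorm_real n f + seminorm_real n g"
proof -
  note s = assms[THEN schwartz_smooth]
  have *: "(1 + x\<^sup>2) ^ n * \<bar>(deriv ^^ j) (\<lambda>x. f x + g x) x\<bar> \<le> seminorm_real n f + seminorm_real n g"
    if "j \<le> n" for n x j
  proof -
    have "(1 + x\<^sup>2) ^ n * \<bar>(deriv ^^ j) (\<lambda>x. f x + g x) x\<bar> \<le>
        (1 + x\<^sup>2) ^ n * (\<bar>(deriv ^^ j) f x\<bar> + \<bar>(deriv ^^ j) g x\<bar>)"
      by (intro mult_left_mono) (auto simp: higher_deriv_add[OF s])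
    also have "\<dots> \<le> seminorm_real n f + seminorm_real n g"
      using seminorm_real_upper[OF assms(1) that] seminorm_real_upper[OF assms(2) that]
      by (simp add: ring_distribs add_mono)
    finally show ?thesis .
  qed
  then show "(\<lambda>x. f x + g x) \<in> schwartz_space"
    unfolding schwartz_space_iff using smooth_add[OF s] by blast
  show "seminorm_real n (\<lambda>x. f x + g x) \<le> seminorm_real n f + seminorm_real n g"
    using * by (rule seminorm_real_least)
qed

lemma
  assumes "f \<in> schwartz_space"
  shows schwartz_cmult: "(\<lambda>x. c * f x) \<in> schwartz_space"
    and seminorm_real_cmult: "seminorm_real n (\<lambda>x. c * f x) \<le> \<bar>c\<bar> * seminorm_real n f"
proof -
  note s = assms[THEN schwartz_smooth]
  have *: "(1 + x\<^sup>2) ^ n * \<bar>(deriv ^^ j) (\<lambda>x. c * f x) x\<bar> \<le> \<bar>c\<bar> * seminorm_real n f"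
    if "j \<le> n" for n x j
    using mult_left_mono[OF seminorm_real_upper[OF assms(1) that], of "\<bar>c\<bar>" x]
    by (simp add: higher_deriv_cmult[OF s] abs_mult mult_ac)
  then show "(\<lambda>x. c * f x) \<in> schwartz_space"
    unfolding schwartz_space_iff using smooth_cmult[OF s] by blast
  show "seminorm_real n (\<lambda>x. c * f x) \<le> \<bar>c\<bar> * seminorm_real n f"
    using * by (rule seminorm_real_least)
qed

lemma schwartz_diff:
  assumes "f \<in> schwartz_space" "g \<in> schwartz_space"
  shows "(\<lambda>x. f x - g x) \<in> schwartz_space"
  using schwartz_add[OF assms(1) schwartz_cmult[OF assms(2), of "-1"]] by simp

lemma seminorm_real_triangle:
  assumes "f \<in> schwartz_space" "g \<in> schwartz_space" "h \<in> schwartz_space"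
  shows "seminorm_real n (\<lambda>x. f x - h x) \<le>
    seminorm_real n (\<lambda>x. f x - g x) + seminorm_real n (\<lambda>x. g x - h x)"
  using seminorm_real_add[OF schwartz_diff[OF assms(1,2)] schwartz_diff[OF assms(2,3)]] by simp

lemma seminorm_real_minus_commute:
  assumes "f \<in> schwartz_space" "g \<in> schwartz_space"
  shows "seminorm_real n (\<lambda>x. f x - g x) = seminorm_real n (\<lambda>x. g x - f x)"
  using seminorm_real_cmult[OF schwartz_diff[OF assms], of n "-1"]
   seminorm_real_cmult[OF schwartz_diff[OF assms(2,1)], of n "-1"] by simp

lemma schwartz_deriv: "f \<in> schwartz_space \<Longrightarrow> deriv f \<in> schwartz_space"
  unfolding schwartz_space_iff
proof (intro conjI allI)
  fix n assume *: "smooth f \<and> (\<forall>n. \<exists>B. \<forall>x. \<forall>j\<le>n. (1 + x\<^sup>2) ^ n * \<bar>(deriv ^^ j) f x\<bar> \<le> B)"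
  then show "smooth (deriv f)" by (simp add: smooth_deriv)
  from * have "f \<in> schwartz_space" by (simp add: schwartz_space_iff)
  have "(1 + x\<^sup>2) ^ n * \<bar>(deriv ^^ j) (deriv f) x\<bar> \<le> seminorm_real (Suc n) f" if "j \<le> n" for x j
  proof -
    have "(1 + x\<^sup>2) ^ n * \<bar>(deriv ^^ Suc j) f x\<bar> \<le> (1 + x\<^sup>2) ^ Suc n * \<bar>(deriv ^^ Suc j) f x\<bar>"
      by (intro mult_right_mono power_increasing) auto
    also have "\<dots> \<le> seminorm_real (Suc n) f"
      by (rule seminorm_real_upper) (use that \<open>f \<in> schwartz_space\<close> in auto)
    finally show ?thesis by (simp add: funpow_swap1)
  qed
  then show "\<exists>B. \<forall>x. \<forall>j\<le>n. (1 + x\<^sup>2) ^ n * \<bar>(deriv ^^ j) (deriv f) x\<bar> \<le> B" by blast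
qed

lemma schwartz_higher_deriv: "f \<in> schwartz_space \<Longrightarrow> (deriv ^^ k) f \<in> schwartz_space"
  by (induction k) (auto simp: schwartz_deriv)

lemma schwartz_zero: "(\<lambda>x. 0) \<in> schwartz_space"
  by (simp add: schwartz_space_def schwartz_seminorm_zero smooth_def deriv_funpow_zero)

lemma seminorm_real_zero: "seminorm_real n (\<lambda>x. 0) = 0"
  by (simp add: seminorm_real_def schwartz_seminorm_zero)

lemma schwartz_ball_eq:
  assumes "f \<in> schwartz_space"
  shows "schwartz_ball n f e = {g \<in> schwartz_space. seminorm_real n (\<lambda>x. g x - f x) < e}"
  using assms by (auto simp: schwartz_ball_def schwartz_seminorm_eq schwartz_diff)

lemma openin_schwartz_ball:
  assumes "f \<in> schwartz_space" "e > 0" shows "openin schwartz_topology (schwartz_ball n f e)"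
  unfolding schwartz_topology_def by (rule topology_generated_by_Basis) (use assms in blast)

lemma schwartz_ball_center: "f \<in> schwartz_space \<Longrightarrow> e > 0 \<Longrightarrow> f \<in> schwartz_ball n f e"
  by (simp add: schwartz_ball_eq seminorm_real_zero)

lemma openin_schwartz_topology_ball:
  assumes "openin schwartz_topology U" "u \<in> U"
  shows "\<exists>n. \<exists>e>0. schwartz_ball n u e \<subseteq> U"
proof -
  have "generate_topology_on {schwartz_ball n f e | n f e. f \<in> schwartz_space \<and> e > 0} U"
    using assms(1) by (simp add: schwartz_topology_def openin_topology_generated_by_iff)
  moreover have "U \<subseteq> schwartz_space" using openin_subset[OF assms(1)] by simp
  ultimately show ?thesis using assms(2)
  proof (induction arbitrary: u)
    case (Int a b)
    have "a \<inter> b \<subseteq> schwartz_space" using Int by blast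
    then have u: "u \<in> schwartz_space" using Int by blast
    have sub: "x \<subseteq> schwartz_space" if "generate_topology_on {schwartz_ball n f e | n f e. f \<in> schwartz_space \<and> e > 0} x" for x
      using that openin_subset[of schwartz_topology x]
      by (simp add: schwartz_topology_def[symmetric] openin_topology_generated_by_iff[symmetric])
    obtain n d where n: "d > 0" "schwartz_ball n u d \<subseteq> a" using Int sub by blast
    obtain m e where m: "e > 0" "schwartz_ball m u e \<subseteq> b" using Int sub by blast
    have "schwartz_ball (max n m) u (min d e) \<subseteq> schwartz_ball n u d \<inter> schwartz_ball m u e"
    proof
      fix g assume g: "g \<in> schwartz_ball (max n m) u (min d e)"
      then have "(\<lambda>x. g x - u x) \<in> schwartz_space"
        using u by (simp add: schwartz_ball_eq schwartz_diff)
      from seminorm_real_mono[OF this, of n "max n m"] seminorm_real_mono[OF this, of m "max n m"] g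
      show "g \<in> schwartz_ball n u d \<inter> schwartz_ball m u e"
        by (simp add: schwartz_ball_eq[OF u])
    qed
    with n m show ?case by (intro exI[of _ "max n m"] exI[of _ "min d e"]) auto
  next
    case (UN K)
    then obtain k where k: "k \<in> K" "u \<in> k" by blast
    moreover have "k \<subseteq> schwartz_space" using UN.prems k by blast
    ultimately obtain n e where "e > 0" "schwartz_ball n u e \<subseteq> k" using UN.IH by blast
    with k show ?case by blast
  next
    case (Basis s)
    then obtain n f e where s: "s = schwartz_ball n f e" "f \<in> schwartz_space" "e > 0" by blast
    with Basis have u: "u \<in> schwartz_space" "seminorm_real n (\<lambda>x. u x - f x) < e"
      by (auto simp: schwartz_ball_eq)
    have "schwartz_ball n u (e - seminorm_real n (\<lambda>x. u x - f x)) \<subseteq> s"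
    proof
      fix g assume "g \<in> schwartz_ball n u (e - seminorm_real n (\<lambda>x. u x - f x))"
      then show "g \<in> s"
        using seminorm_real_triangle[of g u f n] s u by (auto simp: schwartz_ball_eq)
    qed
    with u show ?case by (intro exI[of _ n] exI[of _ "e - seminorm_real n (\<lambda>x. u x - f x)"]) auto
  qed auto
qed

lemma closedin_schwartz_topology_iff:
  "closedin schwartz_topology R \<longleftrightarrow> R \<subseteq> schwartz_space \<and>
     (\<forall>g\<in>schwartz_space. (\<forall>n. \<forall>e>0. \<exists>r\<in>R. seminorm_real n (\<lambda>x. r x - g x) < e) \<longrightarrow> g \<in> R)"
  (is "_ \<longleftrightarrow> _ \<and> ?Q")
proof (cases "R \<subseteq> schwartz_space")
  case True
  have "openin schwartz_topology (schwartz_space - R) \<longleftrightarrow>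
      (\<forall>g\<in>schwartz_space - R. \<exists>n. \<exists>e>0. schwartz_ball n g e \<subseteq> schwartz_space - R)"
  proof
    assume *: "\<forall>g\<in>schwartz_space - R. \<exists>n. \<exists>e>0. schwartz_ball n g e \<subseteq> schwartz_space - R"
    show "openin schwartz_topology (schwartz_space - R)"
    proof (subst openin_subopen, intro ballI)
      fix g assume g: "g \<in> schwartz_space - R"
      with * obtain n e where "e > 0" "schwartz_ball n g e \<subseteq> schwartz_space - R" by blast
      with g show "\<exists>T. openin schwartz_topology T \<and> g \<in> T \<and> T \<subseteq> schwartz_space - R"
        by (intro exI[of _ "schwartz_ball n g e"])
          (simp add: openin_schwartz_ball schwartz_ball_center)
    qed
  qed (use openin_schwartz_topology_ball in blast)
  also have "\<dots> \<longleftrightarrow> ?Q"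
  proof -
    have "schwartz_ball n g e \<subseteq> schwartz_space - R \<longleftrightarrow> (\<forall>r\<in>R. \<not> seminorm_real n (\<lambda>x. r x - g x) < e)"
      if "g \<in> schwartz_space" for n g e
      using True by (auto simp: schwartz_ball_eq[OF that])
    then have "(\<forall>g\<in>schwartz_space - R. \<exists>n. \<exists>e>0. schwartz_ball n g e \<subseteq> schwartz_space - R) \<longleftrightarrow>
      (\<forall>g\<in>schwartz_space - R. \<exists>n. \<exists>e>0. \<forall>r\<in>R. \<not> seminorm_real n (\<lambda>x. r x - g x) < e)"
      by simp
    also have "\<dots> \<longleftrightarrow> ?Q" by blast
    finally show ?thesis .
  qed
  finally show ?thesis using True by (simp add: closedin_def)
qed (simp add: closedin_def)

section \<open>Completeness and uniform boundedness\<close>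

text \<open>\<open>v k\<close> plays the role of the \<open>k\<close>-th derivative of a Schwartz function on \<open>I\<close>.\<close>
definition schwartz_jet :: "real set \<Rightarrow> (nat \<Rightarrow> real \<Rightarrow> real) \<Rightarrow> bool" where
  "schwartz_jet I v \<longleftrightarrow>
     (\<forall>k. \<forall>x\<in>I. (v k has_field_derivative v (Suc k) x) (at x within I)) \<and>
     (\<forall>n. \<exists>B. \<forall>x\<in>I. \<forall>j\<le>n. (1 + x\<^sup>2) ^ n * \<bar>v j x\<bar> \<le> B)"

lemma
  assumes "schwartz_jet UNIV v"
  shows schwartz_jet_UNIV: "v 0 \<in> schwartz_space"
    and higher_deriv_schwartz_jet: "(deriv ^^ k) (v 0) = v k"
proof -
  have v: "(v k has_field_derivative v (Suc k) x) (at x)" for k x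
    using assms by (simp add: schwartz_jet_def)
  show *: "(deriv ^^ k) (v 0) = v k" for k
    using higher_deriv_jet[of v, OF v] .
  show "v 0 \<in> schwartz_space"
    unfolding schwartz_space_iff * using smooth_jet[of v, OF v] assms by (simp add: schwartz_jet_def)
qed

lemma schwartz_space_jet:
  assumes "f \<in> schwartz_space"
  shows "schwartz_jet I (\<lambda>k. (deriv ^^ k) f)"
  unfolding schwartz_jet_def
proof (intro conjI allI ballI)
  show "((deriv ^^ k) f has_field_derivative (deriv ^^ Suc k) f x) (at x within I)" for k x
    by (rule has_field_derivative_at_within[OF smooth_has_derivative[OF schwartz_smooth[OF assms]]])
  show "\<exists>B. \<forall>x\<in>I. \<forall>j\<le>n. (1 + x\<^sup>2) ^ n * \<bar>(deriv ^^ j) f x\<bar> \<le> B" for n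
    using seminorm_real_upper[OF assms] by blast
qed

lemma schwartz_jet_limit:
  fixes f :: "nat \<Rightarrow> real \<Rightarrow> real"
  assumes "convex I" and f: "\<And>n. f n \<in> schwartz_space"
    and cauchy: "\<And>N e. 0 < e \<Longrightarrow> \<exists>M. \<forall>m\<ge>M. \<forall>n\<ge>M. \<forall>x\<in>I. \<forall>j\<le>N.
      (1 + x\<^sup>2) ^ N * \<bar>(deriv ^^ j) (f m) x - (deriv ^^ j) (f n) x\<bar> \<le> e"
  obtains v where "schwartz_jet I v"
    and "\<And>N e. 0 < e \<Longrightarrow> \<exists>M. \<forall>n\<ge>M. \<forall>x\<in>I. \<forall>j\<le>N.
      (1 + x\<^sup>2) ^ N * \<bar>(deriv ^^ j) (f n) x - v j x\<bar> \<le> e"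
proof -
  define v where "v = (\<lambda>j x. lim (\<lambda>n. (deriv ^^ j) (f n) x))"
  have lim: "(\<lambda>n. (deriv ^^ j) (f n) x) \<longlonglongrightarrow> v j x" if "x \<in> I" for j x
  proof -
    have "Cauchy (\<lambda>n. (deriv ^^ j) (f n) x)"
    proof (rule CauchyI)
      fix e :: real assume "0 < e"
      then obtain M where M: "\<forall>m\<ge>M. \<forall>n\<ge>M. \<forall>x\<in>I. \<forall>i\<le>j.
          (1 + x\<^sup>2) ^ j * \<bar>(deriv ^^ i) (f m) x - (deriv ^^ i) (f n) x\<bar> \<le> e / 2"
        using cauchy[of "e / 2" j] by auto
      have "norm ((deriv ^^ j) (f m) x - (deriv ^^ j) (f n) x) < e" if "m \<ge> M" "n \<ge> M" for m n
      proof -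
        have "1 * \<bar>(deriv ^^ j) (f m) x - (deriv ^^ j) (f n) x\<bar> \<le>
            (1 + x\<^sup>2) ^ j * \<bar>(deriv ^^ j) (f m) x - (deriv ^^ j) (f n) x\<bar>"
          by (intro mult_right_mono one_le_weight) auto
        also have "\<dots> \<le> e / 2" using M that \<open>x \<in> I\<close> by blast
        finally show ?thesis using \<open>0 < e\<close> by simp
      qed
      then show "\<exists>M. \<forall>m\<ge>M. \<forall>n\<ge>M. norm ((deriv ^^ j) (f m) x - (deriv ^^ j) (f n) x) < e" by blast
    qed
    then show ?thesis by (simp add: v_def Cauchy_convergent convergent_LIMSEQ_iff[symmetric])
  qed
  have unif: "\<exists>M. \<forall>n\<ge>M. \<forall>x\<in>I. \<forall>j\<le>N. (1 + x\<^sup>2) ^ N * \<bar>(deriv ^^ j) (f n) x - v j x\<bar> \<le> e"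
    if "0 < e" for N e
  proof -
    obtain M where M: "\<forall>m\<ge>M. \<forall>n\<ge>M. \<forall>x\<in>I. \<forall>j\<le>N.
        (1 + x\<^sup>2) ^ N * \<bar>(deriv ^^ j) (f m) x - (deriv ^^ j) (f n) x\<bar> \<le> e"
      using cauchy[OF \<open>0 < e\<close>] by blast
    have "(1 + x\<^sup>2) ^ N * \<bar>(deriv ^^ j) (f n) x - v j x\<bar> \<le> e" if "n \<ge> M" "x \<in> I" "j \<le> N" for n x j
    proof (rule tendsto_upperbound)
      show "(\<lambda>m. (1 + x\<^sup>2) ^ N * \<bar>(deriv ^^ j) (f n) x - (deriv ^^ j) (f m) x\<bar>)
          \<longlonglongrightarrow> (1 + x\<^sup>2) ^ N * \<bar>(deriv ^^ j) (f n) x - v j x\<bar>"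
        by (intro tendsto_intros lim that)
      show "\<forall>\<^sub>F m in sequentially. (1 + x\<^sup>2) ^ N * \<bar>(deriv ^^ j) (f n) x - (deriv ^^ j) (f m) x\<bar> \<le> e"
        unfolding eventually_sequentially using M that by blast
    qed simp
    then show ?thesis by blast
  qed
  have der: "(v k has_field_derivative v (Suc k) x) (at x within I)" if x: "x \<in> I" for k x
  proof -
    have "\<exists>g. \<forall>x\<in>I. (\<lambda>n. (deriv ^^ k) (f n) x) \<longlonglongrightarrow> g x \<and>
        (g has_derivative (*) (v (Suc k) x)) (at x within I)"
    proof (rule has_derivative_sequence[where f = "\<lambda>n. (deriv ^^ k) (f n)" and
            f' = "\<lambda>n x. (*) ((deriv ^^ Suc k) (f n) x)", OF \<open>convex I\<close> _ _ x lim[OF x]])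
      show "((deriv ^^ k) (f n) has_derivative (*) ((deriv ^^ Suc k) (f n) x)) (at x within I)" for n x
        using has_field_derivative_at_within[OF smooth_has_derivative[OF schwartz_smooth[OF f]]]
        by (simp add: has_field_derivative_def)
    next
      fix e :: real assume "e > 0"
      then obtain M where M: "\<forall>n\<ge>M. \<forall>x\<in>I. \<forall>j\<le>Suc k.
          (1 + x\<^sup>2) ^ Suc k * \<bar>(deriv ^^ j) (f n) x - v j x\<bar> \<le> e" using unif by blast
      have "norm ((deriv ^^ Suc k) (f n) x * h - v (Suc k) x * h) \<le> e * norm h"
        if "n \<ge> M" "x \<in> I" for n x h
      proof -
        have "1 * \<bar>(deriv ^^ Suc k) (f n) x - v (Suc k) x\<bar> \<le>
           (1 + x\<^sup>2) ^ Suc k * \<bar>(deriv ^^ Suc k) (f n) x - v (Suc k) x\<bar>"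
          by (intro mult_right_mono one_le_weight) auto
        also have "\<dots> \<le> e" using M that by blast
        finally have "\<bar>(deriv ^^ Suc k) (f n) x - v (Suc k) x\<bar> * \<bar>h\<bar> \<le> e * \<bar>h\<bar>"
          by (intro mult_right_mono) auto
        then show ?thesis by (simp only: real_norm_def abs_mult[symmetric] left_diff_distrib[symmetric])
      qed
      then show "\<forall>\<^sub>F n in sequentially. \<forall>x\<in>I. \<forall>h.
          norm ((deriv ^^ Suc k) (f n) x * h - v (Suc k) x * h) \<le> e * norm h"
        unfolding eventually_sequentially by blast
    qed
    then obtain g where g: "\<And>x. x \<in> I \<Longrightarrow> (\<lambda>n. (deriv ^^ k) (f n) x) \<longlonglongrightarrow> g x"
      "\<And>x. x \<in> I \<Longrightarrow> (g has_field_derivative v (Suc k) x) (at x within I)"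
      by (auto simp: has_field_derivative_def)
    have "g y = v k y" if "y \<in> I" for y
      using g(1)[OF that] lim[OF that] LIMSEQ_unique by blast
    then show ?thesis
      by (rule has_field_derivative_transform_within[OF g(2)[OF x] zero_less_one x])
  qed
  have bdd: "\<exists>B. \<forall>x\<in>I. \<forall>j\<le>N. (1 + x\<^sup>2) ^ N * \<bar>v j x\<bar> \<le> B" for N
  proof -
    obtain n where n: "\<forall>x\<in>I. \<forall>j\<le>N. (1 + x\<^sup>2) ^ N * \<bar>(deriv ^^ j) (f n) x - v j x\<bar> \<le> 1"
      using unif[of 1 N] by auto
    have "(1 + x\<^sup>2) ^ N * \<bar>v j x\<bar> \<le> seminorm_real N (f n) + 1" if "x \<in> I" "j \<le> N" for x j
    proof -
      have "(1 + x\<^sup>2) ^ N * \<bar>v j x\<bar> \<le> (1 + x\<^sup>2) ^ N *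
          (\<bar>(deriv ^^ j) (f n) x\<bar> + \<bar>(deriv ^^ j) (f n) x - v j x\<bar>)"
        by (intro mult_left_mono) auto
      also have "\<dots> \<le> seminorm_real N (f n) + 1"
        using n that seminorm_real_upper[OF f that(2)] by (simp add: ring_distribs add_mono)
      finally show ?thesis .
    qed
    then show ?thesis by blast
  qed
  show ?thesis
    using that[of v] der bdd unif by (simp add: schwartz_jet_def)
qed

lemma schwartz_complete:
  assumes f: "\<And>n. f n \<in> schwartz_space"
    and step: "\<And>k. seminorm_real k (\<lambda>x. f (Suc k) x - f k x) \<le> (1/2) ^ k"
  obtains u where "u \<in> schwartz_space"
    and "\<And>n. (\<lambda>k. seminorm_real n (\<lambda>x. f k x - u x)) \<longlonglongrightarrow> 0"
proof -
  have tail: "seminorm_real N (\<lambda>x. f m x - f k x) \<le> 2 * (1/2) ^ k - 2 * (1/2) ^ m"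
    if "N \<le> k" "k \<le> m" for N k m
    using that(2)
  proof (induction m rule: dec_induct)
    case (step m)
    have "seminorm_real N (\<lambda>x. f (Suc m) x - f m x) \<le> (1/2) ^ m"
      using order_trans[OF seminorm_real_mono[OF schwartz_diff[OF f f], of N m] assms(2)] that step by simp
    with step.IH seminorm_real_triangle[OF f f f, of N "Suc m" k m]
    show ?case by simp
  qed (simp add: seminorm_real_zero)
  have *: "\<exists>M. \<forall>m\<ge>M. \<forall>n\<ge>M. \<forall>x\<in>UNIV. \<forall>j\<le>N.
      (1 + x\<^sup>2) ^ N * \<bar>(deriv ^^ j) (f m) x - (deriv ^^ j) (f n) x\<bar> \<le> e" if "0 < e" for N e
  proof -
    obtain K where K: "(1/2::real) ^ K < e / 4" using \<open>0 < e\<close> real_arch_pow_inv[of "e/4" "1/2"] by auto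
    let ?M = "max N K"
    have le: "seminorm_real N (\<lambda>x. f m x - f ?M x) \<le> e / 2" if "m \<ge> ?M" for m
    proof -
      have "(1/2::real) ^ ?M \<le> (1/2) ^ K" by (intro power_decreasing) auto
      moreover have "0 \<le> (1/2::real) ^ m" by simp
      ultimately show ?thesis using tail[of N ?M m] that K by linarith
    qed
    have "(1 + x\<^sup>2) ^ N * \<bar>(deriv ^^ j) (f m) x - (deriv ^^ j) (f n) x\<bar> \<le> e"
      if "m \<ge> ?M" "n \<ge> ?M" "j \<le> N" for m n x j
    proof -
      have "(1 + x\<^sup>2) ^ N * \<bar>(deriv ^^ j) (f m) x - (deriv ^^ j) (f n) x\<bar> \<le>
          seminorm_real N (\<lambda>x. f m x - f n x)"
        using seminorm_real_upper[OF schwartz_diff[OF f f] that(3), of x m n]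
        by (simp add: higher_deriv_diff[OF schwartz_smooth[OF f] schwartz_smooth[OF f]])
      also have "\<dots> \<le> e"
        using seminorm_real_triangle[OF f f f, of N m n ?M] le[OF that(1)] le[OF that(2)]
        by (simp add: seminorm_real_minus_commute[OF f f, of N ?M n])
      finally show ?thesis .
    qed
    then show ?thesis by blast
  qed
  obtain v where v: "schwartz_jet UNIV v" "\<And>N e. 0 < e \<Longrightarrow> \<exists>M. \<forall>n\<ge>M. \<forall>x\<in>UNIV. \<forall>j\<le>N.
      (1 + x\<^sup>2) ^ N * \<bar>(deriv ^^ j) (f n) x - v j x\<bar> \<le> e"
    using schwartz_jet_limit[OF convex_UNIV f *] by blast
  note v0 = schwartz_jet_UNIV[OF v(1)] higher_deriv_schwartz_jet[OF v(1)]
  show thesis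
  proof (rule that[OF v0(1)])
    fix N
    show "(\<lambda>k. seminorm_real N (\<lambda>x. f k x - v 0 x)) \<longlonglongrightarrow> 0"
    proof (rule LIMSEQ_I)
      fix e :: real assume "0 < e"
      then obtain M where M: "\<forall>n\<ge>M. \<forall>x\<in>UNIV. \<forall>j\<le>N.
          (1 + x\<^sup>2) ^ N * \<bar>(deriv ^^ j) (f n) x - v j x\<bar> \<le> e/2" using v(2)[of "e/2" N] half_gt_zero[OF \<open>0 < e\<close>] by blast
      have "seminorm_real N (\<lambda>x. f n x - v 0 x) \<le> e/2" if "n \<ge> M" for n
        by (rule seminorm_real_least)
          (use M that in \<open>simp add: higher_deriv_diff[OF schwartz_smooth[OF f] schwartz_smooth[OF v0(1)]] v0(2)\<close>)
      then have "\<forall>n\<ge>M. norm (seminorm_real N (\<lambda>x. f n x - v 0 x) - 0) < e"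
        using \<open>0 < e\<close> by (force simp: seminorm_real_nonneg)
      then show "\<exists>M. \<forall>n\<ge>M. norm (seminorm_real N (\<lambda>x. f n x - v 0 x) - 0) < e" by blast
    qed
  qed
qed

text \<open>Nested seminorm balls play the role of the Baire category theorem: on the \<open>k\<close>-th ball some
  functional exceeds \<open>k\<close> in absolute value.\<close>
lemma schwartz_uniform_boundedness:
  fixes L :: "'i \<Rightarrow> (real \<Rightarrow> real) \<Rightarrow> real"
  assumes closed: "closedin schwartz_topology R"
    and zero: "(\<lambda>x. 0) \<in> R"
    and add: "\<And>f g. f \<in> R \<Longrightarrow> g \<in> R \<Longrightarrow> (\<lambda>x. f x + g x) \<in> R"
    and cmult: "\<And>c f. f \<in> R \<Longrightarrow> (\<lambda>x. c * f x) \<in> R"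
    and L_add: "\<And>i f g. i \<in> A \<Longrightarrow> f \<in> R \<Longrightarrow> g \<in> R \<Longrightarrow> L i (\<lambda>x. f x + g x) = L i f + L i g"
    and L_cmult: "\<And>i c f. i \<in> A \<Longrightarrow> f \<in> R \<Longrightarrow> L i (\<lambda>x. c * f x) = c * L i f"
    and cont: "\<And>i. i \<in> A \<Longrightarrow> \<exists>C m. \<forall>f\<in>R. \<bar>L i f\<bar> \<le> C * seminorm_real m f"
    and bdd: "\<And>f. f \<in> R \<Longrightarrow> \<exists>B. \<forall>i\<in>A. \<bar>L i f\<bar> \<le> B"
  shows "\<exists>C m. \<forall>f\<in>R. \<forall>i\<in>A. \<bar>L i f\<bar> \<le> C * seminorm_real m f"
proof (rule ccontr)
  assume "\<not> ?thesis"
  then have unbdd: "\<exists>f\<in>R. \<exists>i\<in>A. C * seminorm_real m f < \<bar>L i f\<bar>" for C m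
    by (meson not_less)
  have RS: "f \<in> schwartz_space" if "f \<in> R" for f
    using that closed by (auto simp: closedin_schwartz_topology_iff)
  have diff: "(\<lambda>x. f x - g x) \<in> R" if "f \<in> R" "g \<in> R" for f g
    using add[OF that(1) cmult[OF that(2), of "-1"]] by simp
  have L_diff: "L i (\<lambda>x. f x - g x) = L i f - L i g" if "i \<in> A" "f \<in> R" "g \<in> R" for i f g
    using L_add[OF that(1,2) cmult[OF that(3), of "-1"]] L_cmult[OF that(1,3), of "-1"] by simp
  have perturb: "\<exists>y\<in>R. \<exists>i\<in>A. seminorm_real m (\<lambda>t. y t - x t) \<le> e \<and> K < \<bar>L i y\<bar>"
    if "x \<in> R" "0 < e" "0 \<le> K" for x m e K
  proof -
    obtain B where B: "\<And>i. i \<in> A \<Longrightarrow> \<bar>L i x\<bar> \<le> B" using bdd[OF \<open>x \<in> R\<close>] by blast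
    define K' where "K' = K + \<bar>B\<bar> + 1"
    have "K' > 0" using that by (simp add: K'_def)
    obtain f i where f: "f \<in> R" "i \<in> A" "K' / e * seminorm_real m f < \<bar>L i f\<bar>"
      using unbdd by blast
    have "0 \<le> K' / e * seminorm_real m f"
      using \<open>0 < K'\<close> \<open>0 < e\<close> seminorm_real_nonneg by simp
    then have Lf: "0 < \<bar>L i f\<bar>" using f(3) by linarith
    define t where "t = K' / \<bar>L i f\<bar>"
    have t: "t > 0" using Lf \<open>0 < K'\<close> by (simp add: t_def)
    have h: "(\<lambda>s. t * f s) \<in> R" using cmult f by blast
    have Lh: "\<bar>L i (\<lambda>s. t * f s)\<bar> = K'"
      using L_cmult[OF f(2,1), of t] t Lf by (simp add: abs_mult) (simp add: t_def)
    have "seminorm_real m (\<lambda>s. t * f s) \<le> t * seminorm_real m f"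
      using seminorm_real_cmult[OF RS[OF f(1)], of m t] t by simp
    also have "\<dots> \<le> e"
    proof -
      have "K' * seminorm_real m f \<le> e * \<bar>L i f\<bar>" using f(3) \<open>0 < e\<close> by (simp add: field_simps)
      then show ?thesis using Lf by (simp add: t_def divide_simps)
    qed
    finally have s: "seminorm_real m (\<lambda>s. t * f s) \<le> e" .
    have "K < \<bar>L i (\<lambda>s. x s + t * f s)\<bar>"
      using L_add[OF f(2) that(1) h] Lh B[OF f(2)] by (simp add: K'_def)
    then show ?thesis
      using add[OF that(1) h] f(2) s
      by (intro bexI[of _ "\<lambda>s. x s + t * f s"] bexI[of _ i]) auto
  qed
  define good where "good = (\<lambda>y m (e::real) (K::real). \<exists>i\<in>A. \<forall>z\<in>R. seminorm_real m (\<lambda>t. z t - y t) \<le> e \<longrightarrow> K < \<bar>L i z\<bar>)"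
  have step: "\<exists>y m' e'. y \<in> R \<and> k \<le> m' \<and> m \<le> m' \<and> 0 < e' \<and> e' \<le> e / 2 \<and>
      seminorm_real m (\<lambda>t. y t - x t) \<le> e / 2 \<and> good y m' e' K"
    if "x \<in> R" "0 < e" "0 \<le> K" for x m k and e K :: real
  proof -
    obtain y i where y: "y \<in> R" "i \<in> A" "seminorm_real m (\<lambda>t. y t - x t) \<le> e / 2" "K + 1 < \<bar>L i y\<bar>"
      using perturb[of x "e / 2" "K + 1" m] \<open>x \<in> R\<close> \<open>0 < e\<close> \<open>0 \<le> K\<close> by auto
    obtain C n where C: "\<And>f. f \<in> R \<Longrightarrow> \<bar>L i f\<bar> \<le> C * seminorm_real n f" using cont[OF y(2)] by blast
    define m' where "m' = max (max k m) n"
    define e' where "e' = min (e / 2) (1 / (\<bar>C\<bar> + 1))"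
    have "K < \<bar>L i z\<bar>" if z: "z \<in> R" "seminorm_real m' (\<lambda>t. z t - y t) \<le> e'" for z
    proof -
      have "\<bar>L i z - L i y\<bar> \<le> C * seminorm_real n (\<lambda>t. z t - y t)"
        using C[OF diff[OF z(1) y(1)]] L_diff[OF y(2) z(1) y(1)] by simp
      also have "\<dots> \<le> (\<bar>C\<bar> + 1) * seminorm_real n (\<lambda>t. z t - y t)"
        by (intro mult_right_mono seminorm_real_nonneg) auto
      also have "\<dots> \<le> (\<bar>C\<bar> + 1) * (1 / (\<bar>C\<bar> + 1))"
        using seminorm_real_mono[OF RS[OF diff[OF z(1) y(1)]], of n m'] z(2)
        by (intro mult_left_mono) (auto simp: m'_def e'_def)
      also have "\<dots> = 1" by simp
      finally show ?thesis using y(4) by linarith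
    qed
    then have "good y m' e' K" using y(2) by (auto simp: good_def)
    moreover have "0 < e'" "e' \<le> e / 2" using that(2) by (auto simp: e'_def add_nonneg_pos)
    moreover have "k \<le> m'" "m \<le> m'" by (auto simp: m'_def)
    ultimately show ?thesis using y by blast
  qed
  let ?P = "\<lambda>k s. fst s \<in> R \<and> k \<le> fst (snd s) \<and> 0 < snd (snd s) \<and> snd (snd s) \<le> (1/2::real) ^ k"
  let ?Q = "\<lambda>k s s'. fst (snd s) \<le> fst (snd s') \<and> snd (snd s') \<le> snd (snd s) / 2 \<and>
    seminorm_real (fst (snd s)) (\<lambda>t. fst s' t - fst s t) \<le> snd (snd s) / 2 \<and>
    good (fst s') (fst (snd s')) (snd (snd s')) (real k)"
  have "\<exists>F. \<forall>k. ?P k (F k) \<and> ?Q k (F k) (F (Suc k))"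
  proof (rule dependent_nat_choice)
    show "\<exists>x. ?P 0 x" using zero by (intro exI[of _ "((\<lambda>x. 0), 0, 1)"]) simp
  next
    fix s k assume P: "?P k s"
    obtain y m' e' where *: "y \<in> R" "Suc k \<le> m'" "fst (snd s) \<le> m'" "0 < e'" "e' \<le> snd (snd s) / 2"
      "seminorm_real (fst (snd s)) (\<lambda>t. y t - fst s t) \<le> snd (snd s) / 2" "good y m' e' (real k)"
      using step[of "fst s" "snd (snd s)" "real k" "Suc k" "fst (snd s)"] P by auto
    have "e' \<le> (1/2) ^ Suc k" using P *(5) by simp
    with * have "?P (Suc k) (y, m', e') \<and> ?Q k s (y, m', e')" by simp
    then show "\<exists>s'. ?P (Suc k) s' \<and> ?Q k s s'" by (rule exI)
  qed
  then obtain F where F: "\<forall>k. ?P k (F k) \<and> ?Q k (F k) (F (Suc k))" ..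
  define x where "x = (\<lambda>k. fst (F k))"
  define m where "m = (\<lambda>k. fst (snd (F k)))"
  define e where "e = (\<lambda>k. snd (snd (F k)))"
  have xR: "x k \<in> R" and m: "k \<le> m k" and e: "0 < e k" "e k \<le> (1/2) ^ k"
    and m_Suc: "m k \<le> m (Suc k)" and e_Suc: "e (Suc k) \<le> e k / 2"
    and x_Suc: "seminorm_real (m k) (\<lambda>t. x (Suc k) t - x k t) \<le> e k / 2"
    and good: "good (x (Suc k)) (m (Suc k)) (e (Suc k)) (real k)" for k
    using F[rule_format, of k] by (simp_all add: x_def m_def e_def)
  have xS: "x k \<in> schwartz_space" for k using RS[OF xR] .
  have "seminorm_real k (\<lambda>t. x (Suc k) t - x k t) \<le> (1/2) ^ k" for k
    using seminorm_real_mono[OF schwartz_diff[OF xS xS] m, of k "Suc k" k] x_Suc[of k] e[of k] by linarith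
  from schwartz_complete[OF xS this] obtain u where u: "u \<in> schwartz_space"
    "\<And>n. (\<lambda>k. seminorm_real n (\<lambda>t. x k t - u t)) \<longlonglongrightarrow> 0" by blast
  have "u \<in> R"
  proof -
    have "\<exists>r\<in>R. seminorm_real n (\<lambda>t. r t - u t) < d" if "d > 0" for n d
    proof -
      have "\<exists>k. seminorm_real n (\<lambda>t. x k t - u t) < d"
        using order_tendstoD(2)[OF u(2) that] by (meson eventually_happens trivial_limit_sequentially)
      then show ?thesis using xR by blast
    qed
    then show ?thesis using closed u(1) by (simp add: closedin_schwartz_topology_iff)
  qed
  have nested: "seminorm_real (m k) (\<lambda>t. x j t - x k t) \<le> e k - e j" if "k \<le> j" for k j
    using that
  proof (induction j rule: dec_induct)
    case (step j)
    have "m k \<le> m j" using lift_Suc_mono_le[of m, OF m_Suc step(1)] .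
    then have "seminorm_real (m k) (\<lambda>t. x (Suc j) t - x j t) \<le> e j / 2"
      using seminorm_real_mono[OF schwartz_diff[OF xS xS]] x_Suc order_trans by blast
    then show ?case
      using seminorm_real_triangle[OF xS xS xS, of "m k" "Suc j" k j] step e_Suc[of j] by linarith
  qed (simp add: seminorm_real_zero)
  have near: "seminorm_real (m k) (\<lambda>t. u t - x k t) \<le> e k" for k
  proof (rule tendsto_lowerbound)
    show "(\<lambda>j. seminorm_real (m k) (\<lambda>t. x j t - u t) + e k) \<longlonglongrightarrow> e k"
      using tendsto_add[OF u(2)[of "m k"] tendsto_const[of "e k"]] by simp
    show "\<forall>\<^sub>F j in sequentially. seminorm_real (m k) (\<lambda>t. u t - x k t) \<le>
        seminorm_real (m k) (\<lambda>t. x j t - u t) + e k"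
      unfolding eventually_sequentially
    proof (intro exI[of _ k] allI impI)
      fix j assume "k \<le> j"
      then show "seminorm_real (m k) (\<lambda>t. u t - x k t) \<le> seminorm_real (m k) (\<lambda>t. x j t - u t) + e k"
        using seminorm_real_triangle[OF u(1) xS xS, of "m k" k j] nested[of k j] e(1)[of j]
          seminorm_real_minus_commute[OF u(1) xS, of "m k" j] by linarith
    qed
  qed simp
  obtain B where B: "\<forall>i\<in>A. \<bar>L i u\<bar> \<le> B" using bdd[OF \<open>u \<in> R\<close>] by blast
  obtain k where k: "B < real k" using reals_Archimedean2 by blast
  obtain i where "i \<in> A" "real k < \<bar>L i u\<bar>"
    using good[of k] near[of "Suc k"] \<open>u \<in> R\<close> unfolding good_def by blast
  with B k show False by force
qed

section \<open>Borel's lemma and extension from half-lines\<close>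

lemma weight_gauss_bounded: "(1 + x\<^sup>2) ^ n * exp (- (x\<^sup>2)) \<le> fact n * exp 1" for x :: real
proof -
  have "(1 + x\<^sup>2) ^ n /\<^sub>R fact n \<le> exp (1 + x\<^sup>2)"
  proof -
    have "(1 + x\<^sup>2) ^ n /\<^sub>R fact n \<le> (\<Sum>k. (1 + x\<^sup>2) ^ k /\<^sub>R fact k)"
      using sum_le_suminf[OF summable_exp_generic[of "1 + x\<^sup>2"], of "{n}"] by simp
    then show ?thesis by (simp add: exp_def)
  qed
  then have "(1 + x\<^sup>2) ^ n \<le> fact n * (exp 1 * exp (x\<^sup>2))"
    by (simp add: exp_add divide_simps mult.commute)
  then show ?thesis by (simp add: exp_minus divide_simps mult_ac)
qed

lemma poly_le_weight: "\<exists>C d. \<forall>x::real. \<bar>poly p x\<bar> \<le> C * (1 + x\<^sup>2) ^ d"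
proof (induction p)
  case (pCons a p)
  then obtain C d where C: "\<And>x. \<bar>poly p x\<bar> \<le> C * (1 + x\<^sup>2) ^ d" by blast
  have "\<bar>poly (pCons a p) x\<bar> \<le> (\<bar>a\<bar> + C) * (1 + x\<^sup>2) ^ Suc d" for x
  proof -
    have "\<bar>poly (pCons a p) x\<bar> \<le> \<bar>a\<bar> * 1 + \<bar>x\<bar> * \<bar>poly p x\<bar>"
      using abs_triangle_ineq[of a "x * poly p x"] by (simp add: abs_mult)
    also have "\<dots> \<le> \<bar>a\<bar> * (1 + x\<^sup>2) ^ Suc d + (1 + x\<^sup>2) * (C * (1 + x\<^sup>2) ^ d)"
    proof (intro add_mono mult_mono C one_le_weight)
      have "2 * \<bar>x\<bar> \<le> 1 + \<bar>x\<bar>\<^sup>2" using zero_le_power2[of "\<bar>x\<bar> - 1"] by (simp add: power2_diff)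
      then show "\<bar>x\<bar> \<le> 1 + x\<^sup>2" unfolding power2_abs by simp
    qed auto
    finally show ?thesis by (simp add: algebra_simps)
  qed
  then show ?case by blast
qed (auto intro: exI[of _ 0])

lemma schwartz_poly_gauss: "(\<lambda>x. poly p x * exp (- (x\<^sup>2))) \<in> schwartz_space"
proof -
  define q where "q = (\<lambda>j. ((\<lambda>q. pderiv q - [:0, 2:] * q) ^^ j) p)"
  let ?v = "\<lambda>j x. poly (q j) x * exp (- (x\<^sup>2))"
  have "schwartz_jet UNIV ?v"
    unfolding schwartz_jet_def
  proof (intro conjI allI ballI)
    fix k and x :: real
    show "(?v k has_real_derivative ?v (Suc k) x) (at x)"
      by (rule derivative_eq_intros refl poly_DERIV)+ (simp add: q_def algebra_simps)
  next
    fix n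
    have "\<exists>B. \<forall>x. (1 + x\<^sup>2) ^ n * \<bar>?v j x\<bar> \<le> B" for j
    proof -
      obtain C d where C: "\<And>x. \<bar>poly (q j) x\<bar> \<le> C * (1 + x\<^sup>2) ^ d" using poly_le_weight by blast
      have "0 \<le> C" using C[of 0] abs_ge_zero[of "poly (q j) 0"] by simp
      have "(1 + x\<^sup>2) ^ n * \<bar>?v j x\<bar> \<le> C * (fact (n + d) * exp 1)" for x
      proof -
        have "(1 + x\<^sup>2) ^ n * \<bar>?v j x\<bar> \<le> (1 + x\<^sup>2) ^ n * (C * (1 + x\<^sup>2) ^ d * exp (- (x\<^sup>2)))"
          by (simp add: abs_mult mult_left_mono C mult_right_mono)
        also have "\<dots> = C * ((1 + x\<^sup>2) ^ (n + d) * exp (- (x\<^sup>2)))" by (simp add: power_add)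
        also have "\<dots> \<le> C * (fact (n + d) * exp 1)"
          by (intro mult_left_mono weight_gauss_bounded \<open>0 \<le> C\<close>)
        finally show ?thesis .
      qed
      then show ?thesis by blast
    qed
    then obtain B where B: "\<And>j x. (1 + x\<^sup>2) ^ n * \<bar>?v j x\<bar> \<le> B j" by metis
    have "(1 + x\<^sup>2) ^ n * \<bar>?v j x\<bar> \<le> Max (B ` {..n})" if "j \<le> n" for j x
      by (rule order_trans[OF B Max_ge]) (use that in auto)
    then show "\<exists>B. \<forall>x\<in>UNIV. \<forall>j\<le>n. (1 + x\<^sup>2) ^ n * \<bar>?v j x\<bar> \<le> B" by blast
  qed
  from schwartz_jet_UNIV[OF this] show ?thesis by (simp add: q_def)
qed

lemma schwartz_monomial_gauss: "(\<lambda>x. x ^ k * exp (- (x\<^sup>2))) \<in> schwartz_space"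
  using schwartz_poly_gauss[of "monom 1 k"] by (simp add: poly_monom)

lemma higher_deriv_monomial_gauss_0:
  fixes k :: nat
  defines "G \<equiv> \<lambda>k x :: real. x ^ k * exp (- (x\<^sup>2))"
  shows "j \<le> k \<Longrightarrow> (deriv ^^ j) (G k) 0 = (if j = k then fact k else 0)"
proof (induction j arbitrary: k)
  case 0
  then show ?case by (simp add: G_def)
next
  case (Suc j)
  then obtain k' where k: "k = Suc k'" "j \<le> k'" by (cases k) auto
  have sm: "smooth (G i)" for i
    unfolding G_def by (rule schwartz_smooth[OF schwartz_monomial_gauss])
  have "deriv (G (Suc k')) = (\<lambda>x. real (Suc k') * G k' x - 2 * G (Suc (Suc k')) x)"
  proof
    fix x
    show "deriv (G (Suc k')) x = real (Suc k') * G k' x - 2 * G (Suc (Suc k')) x"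
      unfolding G_def by (rule DERIV_imp_deriv)
        ((rule derivative_eq_intros refl)+, simp add: algebra_simps power2_eq_square)
  qed
  then have "(deriv ^^ Suc j) (G k) 0 =
      (deriv ^^ j) (\<lambda>x. real (Suc k') * G k' x - 2 * G (Suc (Suc k')) x) 0"
    by (simp add: k funpow_swap1)
  also have "\<dots> = real (Suc k') * (deriv ^^ j) (G k') 0 - 2 * (deriv ^^ j) (G (Suc (Suc k'))) 0"
    by (simp only: higher_deriv_diff[OF smooth_cmult[OF sm] smooth_cmult[OF sm]] higher_deriv_cmult[OF sm])
  finally show ?case using Suc.IH[of k'] Suc.IH[of "Suc (Suc k')"] k by simp
qed

text \<open>Rescaling \<open>x \<mapsto> s x\<close> leaves the derivative of order \<open>k + 1\<close> at \<open>0\<close> prescribed while all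
  derivatives of lower order shrink at least like \<open>1 / s\<close>.\<close>
lemma schwartz_prescribed_derivative:
  assumes "0 < e"
  obtains u where "u \<in> schwartz_space" "seminorm_real k u \<le> e"
    "\<And>i. i \<le> k \<Longrightarrow> (deriv ^^ i) u 0 = 0" "(deriv ^^ Suc k) u 0 = b"
proof -
  define G where "G = (\<lambda>x::real. x ^ Suc k * exp (- (x\<^sup>2)))"
  have GS: "G \<in> schwartz_space" unfolding G_def by (rule schwartz_monomial_gauss)
  note sm = schwartz_smooth[OF GS]
  define s where "s = 1 + \<bar>b\<bar> * seminorm_real k G / e"
  have s: "1 \<le> s" using assms by (simp add: s_def seminorm_real_nonneg)
  define c where "c = b / (fact (Suc k) * s ^ Suc k)"
  define u where "u = (\<lambda>x. c * G (s * x + 0))"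
  have du: "(deriv ^^ i) u = (\<lambda>x. c * (s ^ i * (deriv ^^ i) G (s * x)))" for i
    unfolding u_def
    by (simp only: higher_deriv_cmult[OF smooth_affine[OF sm]] higher_deriv_affine[OF sm]) simp
  have smu: "smooth u" unfolding u_def by (intro smooth_cmult smooth_affine sm)
  have w: "(1 + x\<^sup>2) ^ n * \<bar>(deriv ^^ i) G (s * x)\<bar> \<le> seminorm_real n G" if "i \<le> n" for x n i
  proof -
    have "\<bar>x\<bar> \<le> \<bar>s * x\<bar>" using s by (simp add: abs_mult mult_right_mono[of 1 s "\<bar>x\<bar>", simplified])
    then have "x\<^sup>2 \<le> (s * x)\<^sup>2" by (rule abs_le_square_iff[THEN iffD1])
    then have "(1 + x\<^sup>2) ^ n \<le> (1 + (s * x)\<^sup>2) ^ n"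
      by (intro power_mono) auto
    then have "(1 + x\<^sup>2) ^ n * \<bar>(deriv ^^ i) G (s * x)\<bar> \<le> (1 + (s * x)\<^sup>2) ^ n * \<bar>(deriv ^^ i) G (s * x)\<bar>"
      by (intro mult_right_mono) auto
    also have "\<dots> \<le> seminorm_real n G" by (rule seminorm_real_upper[OF GS that])
    finally show ?thesis .
  qed
  have "u \<in> schwartz_space"
    unfolding schwartz_space_iff
  proof (intro conjI allI smu)
    fix n
    have "(1 + x\<^sup>2) ^ n * \<bar>(deriv ^^ j) u x\<bar> \<le> \<bar>c\<bar> * (s ^ n * seminorm_real n G)" if "j \<le> n" for j x
    proof -
      have "(1 + x\<^sup>2) ^ n * \<bar>(deriv ^^ j) u x\<bar> = \<bar>c\<bar> * (s ^ j * ((1 + x\<^sup>2) ^ n * \<bar>(deriv ^^ j) G (s * x)\<bar>))"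
        using s by (simp add: du abs_mult)
      also have "\<dots> \<le> \<bar>c\<bar> * (s ^ n * seminorm_real n G)"
        using s that by (intro mult_left_mono mult_mono w power_increasing) auto
      finally show ?thesis .
    qed
    then show "\<exists>B. \<forall>x. \<forall>j\<le>n. (1 + x\<^sup>2) ^ n * \<bar>(deriv ^^ j) u x\<bar> \<le> B" by blast
  qed
  moreover have "seminorm_real k u \<le> e"
  proof (rule seminorm_real_least)
    fix x j assume j: "j \<le> k"
    have "(1 + x\<^sup>2) ^ k * \<bar>(deriv ^^ j) u x\<bar> = \<bar>c\<bar> * (s ^ j * ((1 + x\<^sup>2) ^ k * \<bar>(deriv ^^ j) G (s * x)\<bar>))"
      using s by (simp add: du abs_mult)
    also have "\<dots> \<le> \<bar>c\<bar> * (s ^ k * seminorm_real k G)"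
      using s j by (intro mult_left_mono mult_mono w power_increasing) auto
    also have "\<dots> = \<bar>b\<bar> * seminorm_real k G / (fact (Suc k) * s)"
      using s by (simp add: c_def abs_mult divide_simps del: fact_Suc)
    also have "\<dots> \<le> \<bar>b\<bar> * seminorm_real k G / (1 * s)"
      using s by (intro divide_left_mono mult_right_mono fact_ge_1 mult_nonneg_nonneg seminorm_real_nonneg)
        (auto simp del: fact_Suc)
    also have "\<dots> \<le> e"
    proof -
      have "\<bar>b\<bar> * seminorm_real k G \<le> e * s" using assms by (simp add: s_def field_simps)
      then show ?thesis using s by (simp add: divide_simps)
    qed
    finally show "(1 + x\<^sup>2) ^ k * \<bar>(deriv ^^ j) u x\<bar> \<le> e" .
  qed
  moreover have "(deriv ^^ i) u 0 = 0" if "i \<le> k" for i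
    using higher_deriv_monomial_gauss_0[of i "Suc k"] that by (simp add: du G_def)
  moreover have "(deriv ^^ Suc k) u 0 = b"
    using higher_deriv_monomial_gauss_0[of "Suc k" "Suc k"] s
    by (simp only: du) (simp add: c_def G_def del: fact_Suc funpow.simps)
  ultimately show ?thesis using that by blast
qed

lemma schwartz_borel: "\<exists>h\<in>schwartz_space. \<forall>k. (deriv ^^ k) h 0 = c k"
proof -
  let ?P = "\<lambda>k H. H \<in> schwartz_space \<and> (\<forall>i\<le>k. (deriv ^^ i) H 0 = c i)"
  let ?Q = "\<lambda>k H H'. seminorm_real k (\<lambda>x. H' x - H x) \<le> (1/2) ^ k"
  have "\<exists>H. \<forall>k. ?P k (H k) \<and> ?Q k (H k) (H (Suc k))"
  proof (rule dependent_nat_choice)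
    show "\<exists>H. ?P 0 H"
      using schwartz_cmult[OF schwartz_monomial_gauss[of 0], of "c 0"]
      by (intro exI[of _ "\<lambda>x. c 0 * (x ^ 0 * exp (- (x\<^sup>2)))"]) simp
  next
    fix H k assume H: "?P k H"
    obtain u where u: "u \<in> schwartz_space" "seminorm_real k u \<le> (1/2) ^ k"
      "\<And>i. i \<le> k \<Longrightarrow> (deriv ^^ i) u 0 = 0" "(deriv ^^ Suc k) u 0 = c (Suc k) - (deriv ^^ Suc k) H 0"
      using schwartz_prescribed_derivative[of "(1/2) ^ k"] by (metis half_gt_zero_iff zero_less_one zero_less_power)
    have d: "(deriv ^^ i) (\<lambda>x. H x + u x) = (\<lambda>x. (deriv ^^ i) H x + (deriv ^^ i) u x)" for i
      using higher_deriv_add H u(1) schwartz_smooth by blast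
    have "?P (Suc k) (\<lambda>x. H x + u x)"
      unfolding d using H u schwartz_add[of H u] by (auto simp: le_Suc_eq simp del: funpow.simps)
    moreover have "?Q k H (\<lambda>x. H x + u x)" using u by simp
    ultimately show "\<exists>H'. ?P (Suc k) H' \<and> ?Q k H H'" by blast
  qed
  then obtain H where H: "\<And>k. H k \<in> schwartz_space" "\<And>k i. i \<le> k \<Longrightarrow> (deriv ^^ i) (H k) 0 = c i"
    "\<And>k. ?Q k (H k) (H (Suc k))" by blast
  obtain h where h: "h \<in> schwartz_space" "\<And>n. (\<lambda>k. seminorm_real n (\<lambda>x. H k x - h x)) \<longlonglongrightarrow> 0"
    using schwartz_complete[OF H(1,3)] by blast
  have "(deriv ^^ i) h 0 = c i" for i
  proof -
    have "(\<lambda>k. c i - (deriv ^^ i) h 0) \<longlonglongrightarrow> 0"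
    proof (rule Lim_null_comparison[OF _ h(2)[of i]])
      show "\<forall>\<^sub>F k in sequentially. norm (c i - (deriv ^^ i) h 0) \<le> seminorm_real i (\<lambda>x. H k x - h x)"
        unfolding eventually_sequentially
      proof (intro exI[of _ i] allI impI)
        fix k assume "i \<le> k"
        then show "norm (c i - (deriv ^^ i) h 0) \<le> seminorm_real i (\<lambda>x. H k x - h x)"
          using seminorm_real_abs[OF schwartz_diff[OF H(1) h(1)], of i i k 0]
          by (simp add: higher_deriv_diff[OF schwartz_smooth[OF H(1)] schwartz_smooth[OF h(1)]] H(2))
      qed
    qed
    then show ?thesis by (simp add: LIMSEQ_const_iff)
  qed
  with h(1) show ?thesis by blast
qed

lemma schwartz_translate:
  assumes "f \<in> schwartz_space"
  shows "(\<lambda>x. f (x + c)) \<in> schwartz_space"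
  unfolding schwartz_space_iff
proof (intro conjI allI)
  note sm = schwartz_smooth[OF assms]
  show "smooth (\<lambda>x. f (x + c))" using smooth_affine[OF sm, of 1 c] by simp
  fix n
  have "(1 + x\<^sup>2) ^ n * \<bar>(deriv ^^ j) (\<lambda>x. f (x + c)) x\<bar> \<le> (2 * (1 + c\<^sup>2)) ^ n * seminorm_real n f"
    if "j \<le> n" for x j
  proof -
    have "1 + x\<^sup>2 \<le> 2 * (1 + c\<^sup>2) * (1 + (x + c)\<^sup>2)"
    proof -
      have "2 * (1 + c\<^sup>2) * (1 + (x + c)\<^sup>2) - (1 + x\<^sup>2) = (x + 2 * c)\<^sup>2 + 1 + 2 * (c * (x + c))\<^sup>2"
        by (simp add: power2_eq_square algebra_simps)
      moreover have "0 \<le> (x + 2 * c)\<^sup>2 + 1 + 2 * (c * (x + c))\<^sup>2" by simp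
      ultimately show ?thesis by linarith
    qed
    then have "(1 + x\<^sup>2) ^ n \<le> (2 * (1 + c\<^sup>2)) ^ n * (1 + (x + c)\<^sup>2) ^ n"
      unfolding power_mult_distrib[symmetric] by (intro power_mono) auto
    then have "(1 + x\<^sup>2) ^ n * \<bar>(deriv ^^ j) f (x + c)\<bar> \<le>
        (2 * (1 + c\<^sup>2)) ^ n * (1 + (x + c)\<^sup>2) ^ n * \<bar>(deriv ^^ j) f (x + c)\<bar>"
      by (intro mult_right_mono) auto
    also have "\<dots> \<le> (2 * (1 + c\<^sup>2)) ^ n * seminorm_real n f"
      unfolding mult.assoc by (intro mult_left_mono seminorm_real_upper assms that) auto
    finally show ?thesis using higher_deriv_affine[OF sm, of j 1 c] by simp
  qed
  then show "\<exists>B. \<forall>x. \<forall>j\<le>n. (1 + x\<^sup>2) ^ n * \<bar>(deriv ^^ j) (\<lambda>x. f (x + c)) x\<bar> \<le> B" by blast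
qed

lemma schwartz_borel_at: "\<exists>h\<in>schwartz_space. \<forall>k. (deriv ^^ k) h a = c k"
proof -
  obtain h where h: "h \<in> schwartz_space" "\<And>k. (deriv ^^ k) h 0 = c k" using schwartz_borel by blast
  have "(deriv ^^ k) (\<lambda>x. h (x - a)) a = c k" for k
    using higher_deriv_affine[OF schwartz_smooth[OF h(1)], of k 1 "- a"] h(2) by simp
  with schwartz_translate[OF h(1), of "- a"] show ?thesis by auto
qed

lemma schwartz_jet_glue:
  assumes v: "schwartz_jet {..a} v" and w: "schwartz_jet {a..} w" and eq: "\<And>k. v k a = w k a"
  shows "(\<lambda>x. if x \<le> a then v 0 x else w 0 x) \<in> schwartz_space"
proof -
  let ?u = "\<lambda>k x. if x \<in> {..a} then v k x else w k x"
  have "schwartz_jet UNIV ?u"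
    unfolding schwartz_jet_def
  proof (intro conjI allI ballI)
    fix k x
    have cl: "closure {..a} \<inter> closure {a..} = {a}" by auto
    have "(?u k has_vector_derivative ?u (Suc k) x) (at x within UNIV)"
    proof (rule has_vector_derivative_If_within_closures[where T = "{a..}"])
      show "(v k has_vector_derivative v (Suc k) x) (at x within {..a} \<union> closure {..a} \<inter> closure {a..})"
        if "x \<in> {..a} \<union> closure {..a} \<inter> closure {a..}"
        using that v unfolding cl schwartz_jet_def
        by (auto simp: has_real_derivative_iff_has_vector_derivative insert_absorb)
      show "(w k has_vector_derivative w (Suc k) x) (at x within {a..} \<union> closure {..a} \<inter> closure {a..})"
        if "x \<in> {a..} \<union> closure {..a} \<inter> closure {a..}"
        using that w unfolding cl schwartz_jet_def
        by (auto simp: has_real_derivative_iff_has_vector_derivative insert_absorb)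
      show "v k x = w k x" if "x \<in> closure {..a}" "x \<in> closure {a..}" using that eq by auto
      show "v (Suc k) x = w (Suc k) x" if "x \<in> closure {..a}" "x \<in> closure {a..}" using that eq by auto
    qed auto
    then show "(?u k has_real_derivative ?u (Suc k) x) (at x)"
      by (simp add: has_real_derivative_iff_has_vector_derivative)
  next
    fix n
    obtain B C where "\<forall>x\<in>{..a}. \<forall>j\<le>n. (1 + x\<^sup>2) ^ n * \<bar>v j x\<bar> \<le> B"
      "\<forall>x\<in>{a..}. \<forall>j\<le>n. (1 + x\<^sup>2) ^ n * \<bar>w j x\<bar> \<le> C"
      using v w unfolding schwartz_jet_def by blast
    then show "\<exists>B. \<forall>x\<in>UNIV. \<forall>j\<le>n. (1 + x\<^sup>2) ^ n * \<bar>?u j x\<bar> \<le> B"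
      by (intro exI[of _ "max B C"]) (auto simp: le_max_iff_disj)
  qed
  from schwartz_jet_UNIV[OF this] show ?thesis by simp
qed

lemma schwartz_jet_extend:
  assumes "schwartz_jet I v" "convex I" "closed I" "\<not> bounded I"
  obtains f where "f \<in> schwartz_space" "\<And>x. x \<in> I \<Longrightarrow> f x = v 0 x"
proof -
  have "I \<noteq> {}" using assms(4) by auto
  have unb: "\<not> (bdd_above I \<and> bdd_below I)"
  proof
    assume "bdd_above I \<and> bdd_below I"
    then obtain b c where "I \<subseteq> {b..c}" by (fastforce simp: bdd_above_def bdd_below_def)
    then show False using assms(4) bounded_subset[OF bounded_closed_interval] by blast
  qed
  have mid: "y \<in> I" if "x \<in> I" "z \<in> I" "x \<le> y" "y \<le> z" for x y z
    using \<open>convex I\<close> that by (meson is_interval_1 is_interval_convex_1)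
  consider "I = UNIV" | a where "I = {a..}" | a where "I = {..a}"
  proof (cases "bdd_below I")
    case True
    then have Inf: "Inf I \<in> I" using closed_contains_Inf[OF \<open>I \<noteq> {}\<close>] assms(3) by blast
    have "I = {Inf I..}"
    proof (intro equalityI subsetI)
      fix y assume y: "y \<in> {Inf I..}"
      obtain z where "z \<in> I" "y \<le> z" using unb True by (meson bdd_above.I linear)
      then show "y \<in> I" using mid[OF Inf] y by auto
    qed (use True in \<open>auto intro: cInf_lower\<close>)
    then show ?thesis using that by blast
  next
    case below: False
    show ?thesis
    proof (cases "bdd_above I")
      case True
      then have Sup: "Sup I \<in> I" using closed_contains_Sup[OF \<open>I \<noteq> {}\<close>] assms(3) by blast
      have "I = {..Sup I}"
      proof (intro equalityI subsetI)
        fix y assume y: "y \<in> {..Sup I}"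
        obtain z where "z \<in> I" "z \<le> y" using below by (meson bdd_below.I linear)
        then show "y \<in> I" using mid[OF _ Sup] y by auto
      qed (use True in \<open>auto intro: cSup_upper\<close>)
      then show ?thesis using that by blast
    next
      case False
      have "y \<in> I" for y
      proof -
        obtain x z where "x \<in> I" "x \<le> y" "z \<in> I" "y \<le> z"
          using below False by (meson bdd_above.I bdd_below.I linear)
        then show ?thesis using mid by blast
      qed
      then show ?thesis using that by blast
    qed
  qed
  then show thesis
  proof cases
    case 1
    then show thesis using that[of "v 0"] schwartz_jet_UNIV assms(1) by blast
  next
    case (2 a)
    obtain h where h: "h \<in> schwartz_space" "\<And>k. (deriv ^^ k) h a = v k a"
      using schwartz_borel_at[of a "\<lambda>k. v k a"] by blast
    from schwartz_jet_glue[OF schwartz_space_jet[OF h(1)] assms(1)[unfolded 2] h(2)]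
    show thesis by (rule that) (use h(2)[of 0] 2 in auto)
  next
    case (3 a)
    obtain h where h: "h \<in> schwartz_space" "\<And>k. (deriv ^^ k) h a = v k a"
      using schwartz_borel_at[of a "\<lambda>k. v k a"] by blast
    from schwartz_jet_glue[OF assms(1)[unfolded 3] schwartz_space_jet[OF h(1)] h(2)[symmetric]]
    show thesis by (rule that) (use 3 in auto)
  qed
qed

section \<open>Inverting multiplication by the derivative\<close>

lemma higher_deriv_le_product:
  assumes F: "smooth F" "F x \<noteq> 0"
  shows "\<exists>C\<ge>0. \<forall>f\<in>schwartz_space. (\<lambda>x. F x * f x) \<in> schwartz_space \<longrightarrow>
    \<bar>(deriv ^^ j) f x\<bar> \<le> C * seminorm_real j (\<lambda>x. F x * f x)"
proof (induction j rule: less_induct)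
  case (less j)
  then obtain c where c: "\<And>i. i < j \<Longrightarrow> 0 \<le> c i"
    "\<And>i f. i < j \<Longrightarrow> f \<in> schwartz_space \<Longrightarrow> (\<lambda>x. F x * f x) \<in> schwartz_space \<Longrightarrow>
       \<bar>(deriv ^^ i) f x\<bar> \<le> c i * seminorm_real i (\<lambda>x. F x * f x)"
    by metis
  define d where "d = (\<lambda>i. real (j choose i) * (\<bar>(deriv ^^ (j - i)) F x\<bar> * c i))"
  have d: "0 \<le> d i" if "i < j" for i using c(1)[OF that] by (simp add: d_def)
  define C where "C = (1 + (\<Sum>i<j. d i)) / \<bar>F x\<bar>"
  have "0 \<le> C" unfolding C_def using d by (auto intro!: divide_nonneg_nonneg add_nonneg_nonneg sum_nonneg)
  moreover have "\<bar>(deriv ^^ j) f x\<bar> \<le> C * seminorm_real j (\<lambda>x. F x * f x)"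
    if f: "f \<in> schwartz_space" and Ff: "(\<lambda>x. F x * f x) \<in> schwartz_space" for f
  proof -
    let ?p = "seminorm_real j (\<lambda>x. F x * f x)"
    let ?t = "\<lambda>i. real (j choose i) * ((deriv ^^ i) f x * (deriv ^^ (j - i)) F x)"
    have "(deriv ^^ j) (\<lambda>x. F x * f x) x = (\<Sum>i\<le>j. ?t i)"
      using higher_deriv_mult[OF schwartz_smooth[OF f] F(1), of j] by (simp add: mult.commute)
    also have "\<dots> = (\<Sum>i<j. ?t i) + F x * (deriv ^^ j) f x"
      unfolding lessThan_Suc_atMost[symmetric] sum.lessThan_Suc by simp
    finally have "F x * (deriv ^^ j) f x = (deriv ^^ j) (\<lambda>x. F x * f x) x - (\<Sum>i<j. ?t i)" by simp
    then have "\<bar>F x\<bar> * \<bar>(deriv ^^ j) f x\<bar> \<le> \<bar>(deriv ^^ j) (\<lambda>x. F x * f x) x\<bar> + (\<Sum>i<j. \<bar>?t i\<bar>)"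
      using sum_abs[of ?t "{..<j}"] unfolding abs_mult[symmetric] by linarith
    also have "\<dots> \<le> ?p + (\<Sum>i<j. d i * ?p)"
    proof (intro add_mono sum_mono seminorm_real_abs[OF Ff])
      fix i assume "i \<in> {..<j}"
      then have i: "i < j" by simp
      have "\<bar>(deriv ^^ i) f x\<bar> \<le> c i * ?p"
        using c(2)[OF i f Ff] mult_left_mono[OF seminorm_real_mono[OF Ff, of i j] c(1)[OF i]] i
        by simp
      then have "real (j choose i) * (\<bar>(deriv ^^ i) f x\<bar> * \<bar>(deriv ^^ (j - i)) F x\<bar>) \<le>
          real (j choose i) * (c i * ?p * \<bar>(deriv ^^ (j - i)) F x\<bar>)"
        by (intro mult_left_mono mult_right_mono) auto
      then show "\<bar>?t i\<bar> \<le> d i * ?p" by (simp add: d_def abs_mult mult_ac)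
    qed simp
    also have "\<dots> = (1 + (\<Sum>i<j. d i)) * ?p" by (simp add: ring_distribs sum_distrib_right)
    finally show ?thesis using F(2) by (simp add: C_def field_simps)
  qed
  ultimately show ?case by blast
qed

lemma mult_closed_range_bound:
  assumes F: "smooth F" and closed: "has_closed_range (mult_operator F)"
    and W: "\<And>f. f \<in> schwartz_space \<Longrightarrow> (\<lambda>x. W x * f x) \<in> schwartz_space"
  shows "\<exists>C m. \<forall>f\<in>schwartz_space. \<forall>x j. F x \<noteq> 0 \<longrightarrow> j \<le> n \<longrightarrow>
    \<bar>W x\<bar> * ((1 + x\<^sup>2) ^ n * \<bar>(deriv ^^ j) f x\<bar>) \<le> C * seminorm_real m (\<lambda>x. F x * f x)"
proof -
  define R where "R = (\<lambda>f x. F x * f x) ` schwartz_space"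
  have R: "closedin schwartz_topology R"
    using closed unfolding has_closed_range_def mult_operator_def R_def .
  have RS: "(\<lambda>x. F x * f x) \<in> schwartz_space" if "f \<in> schwartz_space" for f
    using R that by (auto simp: closedin_schwartz_topology_iff R_def)
  have RI: "g \<in> R" if "f \<in> schwartz_space" "g = (\<lambda>x. F x * f x)" for f g
    using that by (simp add: R_def)
  define A where "A = {(x, j). F x \<noteq> 0 \<and> j \<le> n}"
  define L where "L = (\<lambda>(x, j) g. W x * ((1 + x\<^sup>2) ^ n * (deriv ^^ j) (\<lambda>t. g t / F t) x))"
  have L: "L (x, j) (\<lambda>x. F x * f x) = W x * ((1 + x\<^sup>2) ^ n * (deriv ^^ j) f x)" if "F x \<noteq> 0" for f x j
  proof -
    have "open {t. F t \<noteq> 0}"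
      using smooth_continuous[OF F, of UNIV 0] by (intro open_Collect_neq) auto
    from higher_deriv_cong_open[OF this, of "\<lambda>t. F t * f t / F t" f x j]
    show ?thesis using that by (simp add: L_def)
  qed
  have "\<exists>C m. \<forall>f\<in>R. \<forall>i\<in>A. \<bar>L i f\<bar> \<le> C * seminorm_real m f"
  proof (rule schwartz_uniform_boundedness[OF R])
    show "(\<lambda>x. 0) \<in> R" by (rule RI[OF schwartz_zero]) simp
  next
    fix f g assume "f \<in> R" "g \<in> R"
    then obtain f' g' where *: "f' \<in> schwartz_space" "f = (\<lambda>x. F x * f' x)"
      "g' \<in> schwartz_space" "g = (\<lambda>x. F x * g' x)" by (auto simp: R_def)
    then have eq: "(\<lambda>x. f x + g x) = (\<lambda>x. F x * (f' x + g' x))" by (simp add: ring_distribs)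
    show "(\<lambda>x. f x + g x) \<in> R" by (rule RI[OF schwartz_add[OF *(1,3)] eq])
    fix i assume "i \<in> A"
    then obtain x j where i: "i = (x, j)" "F x \<noteq> 0" by (auto simp: A_def)
    show "L i (\<lambda>x. f x + g x) = L i f + L i g"
      unfolding eq i(1) unfolding *(2,4) L[OF i(2)]
      by (simp add: higher_deriv_add[OF *(1,3)[THEN schwartz_smooth]] ring_distribs)
  next
    fix c f assume "f \<in> R"
    then obtain f' where *: "f' \<in> schwartz_space" "f = (\<lambda>x. F x * f' x)" by (auto simp: R_def)
    then have eq: "(\<lambda>x. c * f x) = (\<lambda>x. F x * (c * f' x))" by (simp add: mult_ac)
    show "(\<lambda>x. c * f x) \<in> R" by (rule RI[OF schwartz_cmult[OF *(1)] eq])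
    fix i assume "i \<in> A"
    then obtain x j where i: "i = (x, j)" "F x \<noteq> 0" by (auto simp: A_def)
    show "L i (\<lambda>x. c * f x) = c * L i f"
      unfolding eq i(1) unfolding *(2) L[OF i(2)]
      by (simp add: higher_deriv_cmult[OF *(1)[THEN schwartz_smooth]])
  next
    fix i assume "i \<in> A"
    then obtain x j where i: "i = (x, j)" "F x \<noteq> 0" by (auto simp: A_def)
    obtain C where C: "\<And>f. f \<in> schwartz_space \<Longrightarrow>
        \<bar>(deriv ^^ j) f x\<bar> \<le> C * seminorm_real j (\<lambda>x. F x * f x)"
      using higher_deriv_le_product[OF F i(2), of j] RS by blast
    have "\<bar>L i f\<bar> \<le> \<bar>W x\<bar> * (1 + x\<^sup>2) ^ n * C * seminorm_real j f" if f: "f \<in> R" for f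
    proof -
      obtain f' where *: "f' \<in> schwartz_space" "f = (\<lambda>x. F x * f' x)" using f by (auto simp: R_def)
      have "\<bar>L i f\<bar> = \<bar>W x\<bar> * ((1 + x\<^sup>2) ^ n * \<bar>(deriv ^^ j) f' x\<bar>)"
        unfolding i(1) *(2) L[OF i(2)] by (simp add: abs_mult)
      also have "\<dots> \<le> \<bar>W x\<bar> * ((1 + x\<^sup>2) ^ n * (C * seminorm_real j f))"
        unfolding *(2) by (intro mult_left_mono C *(1)) auto
      finally show ?thesis by (simp add: mult_ac)
    qed
    then show "\<exists>C m. \<forall>f\<in>R. \<bar>L i f\<bar> \<le> C * seminorm_real m f" by blast
  next
    fix f assume "f \<in> R"
    then obtain f' where *: "f' \<in> schwartz_space" "f = (\<lambda>x. F x * f' x)" by (auto simp: R_def)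
    let ?s = "\<lambda>j. seminorm_real n (\<lambda>x. W x * (deriv ^^ j) f' x)"
    have "\<bar>L i f\<bar> \<le> (\<Sum>j\<le>n. ?s j)" if "i \<in> A" for i
    proof -
      obtain x j where i: "i = (x, j)" "F x \<noteq> 0" "j \<le> n" using \<open>i \<in> A\<close> by (auto simp: A_def)
      have "\<bar>L i f\<bar> = (1 + x\<^sup>2) ^ n * \<bar>(deriv ^^ 0) (\<lambda>x. W x * (deriv ^^ j) f' x) x\<bar>"
        unfolding i(1) *(2) L[OF i(2)] by (simp add: abs_mult)
      also have "\<dots> \<le> ?s j" by (intro seminorm_real_upper W schwartz_higher_deriv *(1)) simp
      also have "\<dots> \<le> (\<Sum>j\<le>n. ?s j)"
        using i(3) by (intro member_le_sum) (auto simp: seminorm_real_nonneg)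
      finally show ?thesis .
    qed
    then show "\<exists>B. \<forall>i\<in>A. \<bar>L i f\<bar> \<le> B" by blast
  qed
  then obtain C m where C: "\<And>f i. f \<in> R \<Longrightarrow> i \<in> A \<Longrightarrow> \<bar>L i f\<bar> \<le> C * seminorm_real m f" by blast
  have "\<bar>W x\<bar> * ((1 + x\<^sup>2) ^ n * \<bar>(deriv ^^ j) f x\<bar>) \<le> C * seminorm_real m (\<lambda>x. F x * f x)"
    if "f \<in> schwartz_space" "F x \<noteq> 0" "j \<le> n" for f x j
    using C[OF RI[OF that(1) refl], of "(x, j)"] that L[OF that(2), of j f]
    by (simp add: A_def abs_mult)
  then show ?thesis by blast
qed

lemma seminorm_real_le_support:
  assumes g: "smooth g" and supp: "\<And>x. x \<notin> D \<Longrightarrow> g x = 0" and "0 \<le> B"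
    and le: "\<And>x j. x \<in> D \<Longrightarrow> j \<le> m \<Longrightarrow> (1 + x\<^sup>2) ^ m * \<bar>(deriv ^^ j) g x\<bar> \<le> B"
  shows "seminorm_real m g \<le> B"
proof (rule seminorm_real_least)
  fix x j assume j: "j \<le> m"
  show "(1 + x\<^sup>2) ^ m * \<bar>(deriv ^^ j) g x\<bar> \<le> B"
  proof (cases "x \<in> closure D")
    case True
    have "closed {x. (1 + x\<^sup>2) ^ m * \<bar>(deriv ^^ j) g x\<bar> \<le> B}"
      by (intro closed_Collect_le continuous_intros smooth_continuous g)
    then have "closure D \<subseteq> {x. (1 + x\<^sup>2) ^ m * \<bar>(deriv ^^ j) g x\<bar> \<le> B}"
      using le j by (intro closure_minimal) auto
    with True show ?thesis by blast
  next
    case False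
    have "(deriv ^^ j) g x = (deriv ^^ j) (\<lambda>x. 0) x"
      by (rule higher_deriv_cong_open[of "- closure D"])
        (use False supp closure_subset in auto)
    then show ?thesis using \<open>0 \<le> B\<close> by (simp add: deriv_funpow_zero)
  qed
qed

lemma has_closed_range_mult_one: "has_closed_range (mult_operator (\<lambda>x. 1))"
proof -
  have "mult_operator (\<lambda>x. 1) ` schwartz_space = schwartz_space"
    by (simp add: mult_operator_def)
  then show ?thesis
    unfolding has_closed_range_def using closedin_topspace[of schwartz_topology] by simp
qed

lemma schwartz_symbol_comp:
  assumes "schwartz_symbol \<phi>" "f \<in> schwartz_space"
  shows "(\<lambda>x. f (\<phi> x)) \<in> schwartz_space"
  using assms by (auto simp: schwartz_symbol_def comp_def)

text \<open>Writing \<open>f_k\<close> for the derivative of order \<open>k\<close>, one has \<open>\<phi>' (f_(k+1) \<circ> \<phi>) = (f_k \<circ> \<phi>)'\<close>, so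
  inverting multiplication by \<open>\<phi>'\<close> passes from \<open>k\<close> to \<open>k + 1\<close>. The bounds only hold off the zeros
  of \<open>\<phi>'\<close>, but \<open>(f_k \<circ> \<phi>)'\<close> vanishes at these zeros.\<close>
lemma comp_higher_deriv_bound:
  assumes symb: "schwartz_symbol \<phi>" and closed: "has_closed_range (mult_operator (deriv \<phi>))"
    and W: "\<And>f. f \<in> schwartz_space \<Longrightarrow> (\<lambda>x. W x * f x) \<in> schwartz_space"
  shows "\<exists>C m. \<forall>f\<in>schwartz_space. \<forall>x j. deriv \<phi> x \<noteq> 0 \<longrightarrow> j \<le> n \<longrightarrow>
    \<bar>W x\<bar> * ((1 + x\<^sup>2) ^ n * \<bar>(deriv ^^ j) (\<lambda>x. (deriv ^^ k) f (\<phi> x)) x\<bar>) \<le>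
      C * seminorm_real m (\<lambda>x. f (\<phi> x))"
  using W
proof (induction k arbitrary: W n)
  case 0
  have "smooth (\<lambda>x. 1)" using smooth_jet[of "\<lambda>k x. if k = 0 then 1 else 0"] by simp
  from mult_closed_range_bound[OF this has_closed_range_mult_one 0, of n]
  obtain C m where "\<And>f x j. f \<in> schwartz_space \<Longrightarrow> j \<le> n \<Longrightarrow>
     \<bar>W x\<bar> * ((1 + x\<^sup>2) ^ n * \<bar>(deriv ^^ j) f x\<bar>) \<le> C * seminorm_real m f" by auto metis
  with schwartz_symbol_comp[OF symb] have "\<And>f x j. f \<in> schwartz_space \<Longrightarrow> j \<le> n \<Longrightarrow>
     \<bar>W x\<bar> * ((1 + x\<^sup>2) ^ n * \<bar>(deriv ^^ j) (\<lambda>x. f (\<phi> x)) x\<bar>) \<le> C * seminorm_real m (\<lambda>x. f (\<phi> x))"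
    by blast
  then show ?case unfolding funpow_0 by blast
next
  case (Suc k)
  have \<phi>: "smooth \<phi>" using symb by (simp add: schwartz_symbol_def)
  from mult_closed_range_bound[OF smooth_deriv[OF \<phi>] closed Suc.prems, of n]
  obtain C m where C: "\<And>f x j. f \<in> schwartz_space \<Longrightarrow> deriv \<phi> x \<noteq> 0 \<Longrightarrow> j \<le> n \<Longrightarrow>
     \<bar>W x\<bar> * ((1 + x\<^sup>2) ^ n * \<bar>(deriv ^^ j) f x\<bar>) \<le> C * seminorm_real m (\<lambda>x. deriv \<phi> x * f x)" by blast
  from Suc.IH[of "\<lambda>x. 1" "Suc m"]
  obtain C' m' where C': "\<And>f x j. f \<in> schwartz_space \<Longrightarrow> deriv \<phi> x \<noteq> 0 \<Longrightarrow> j \<le> Suc m \<Longrightarrow>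
     (1 + x\<^sup>2) ^ Suc m * \<bar>(deriv ^^ j) (\<lambda>x. (deriv ^^ k) f (\<phi> x)) x\<bar> \<le> C' * seminorm_real m' (\<lambda>x. f (\<phi> x))"
    unfolding mult_1 abs_one by blast
  have "\<bar>W x\<bar> * ((1 + x\<^sup>2) ^ n * \<bar>(deriv ^^ j) (\<lambda>x. (deriv ^^ Suc k) f (\<phi> x)) x\<bar>) \<le>
      \<bar>C\<bar> * \<bar>C'\<bar> * seminorm_real m' (\<lambda>x. f (\<phi> x))"
    if f: "f \<in> schwartz_space" and x: "deriv \<phi> x \<noteq> 0" and j: "j \<le> n" for f x j
  proof -
    define h where "h = (\<lambda>x. (deriv ^^ k) f (\<phi> x))"
    have h: "smooth h" unfolding h_def
      by (rule schwartz_smooth[OF schwartz_symbol_comp[OF symb schwartz_higher_deriv[OF f]]])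
    have dh: "deriv h = (\<lambda>x. deriv \<phi> x * (deriv ^^ Suc k) f (\<phi> x))"
      unfolding h_def
    proof
      fix x
      have "((\<lambda>x. (deriv ^^ k) f (\<phi> x)) has_real_derivative (deriv ^^ Suc k) f (\<phi> x) * deriv \<phi> x) (at x)"
        using smooth_has_derivative[OF \<phi>, of 0]
        by (intro DERIV_chain2[OF smooth_has_derivative[OF schwartz_smooth[OF f]]]) simp
      from DERIV_imp_deriv[OF this]
      show "deriv (\<lambda>x. (deriv ^^ k) f (\<phi> x)) x = deriv \<phi> x * (deriv ^^ Suc k) f (\<phi> x)"
        by (simp add: mult.commute)
    qed
    have "seminorm_real m (deriv h) \<le> \<bar>C'\<bar> * seminorm_real m' (\<lambda>x. f (\<phi> x))"
    proof (rule seminorm_real_le_support[where D = "{x. deriv \<phi> x \<noteq> 0}"])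
      fix y i assume y: "y \<in> {x. deriv \<phi> x \<noteq> 0}" and i: "i \<le> m"
      have "(1 + y\<^sup>2) ^ m * \<bar>(deriv ^^ i) (deriv h) y\<bar> \<le> (1 + y\<^sup>2) ^ Suc m * \<bar>(deriv ^^ Suc i) h y\<bar>"
        unfolding funpow_Suc_right comp_apply by (intro mult_right_mono power_increasing) auto
      also have "\<dots> \<le> C' * seminorm_real m' (\<lambda>x. f (\<phi> x))"
        unfolding h_def by (rule C'[OF f]) (use y i in auto)
      also have "\<dots> \<le> \<bar>C'\<bar> * seminorm_real m' (\<lambda>x. f (\<phi> x))"
        by (intro mult_right_mono seminorm_real_nonneg) simp
      finally show "(1 + y\<^sup>2) ^ m * \<bar>(deriv ^^ i) (deriv h) y\<bar> \<le> \<bar>C'\<bar> * seminorm_real m' (\<lambda>x. f (\<phi> x))" .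
    qed (simp_all add: smooth_deriv[OF h] seminorm_real_nonneg, simp add: dh)
    then have "\<bar>C\<bar> * seminorm_real m (deriv h) \<le> \<bar>C\<bar> * (\<bar>C'\<bar> * seminorm_real m' (\<lambda>x. f (\<phi> x)))"
      by (intro mult_left_mono) auto
    moreover have "C * seminorm_real m (deriv h) \<le> \<bar>C\<bar> * seminorm_real m (deriv h)"
      by (intro mult_right_mono seminorm_real_nonneg) simp
    moreover note C[OF schwartz_symbol_comp[OF symb schwartz_higher_deriv[OF f, of "Suc k"]] x j, folded dh]
    ultimately show ?thesis by (simp add: mult.assoc del: funpow.simps)
  qed
  then show ?case by blast
qed

lemma multiplier_weight:
  assumes "\<phi> \<in> schwartz_multipliers" "f \<in> schwartz_space"
  shows "(\<lambda>x. (1 + (\<phi> x)\<^sup>2) ^ N * f x) \<in> schwartz_space"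
  using assms(2)
proof (induction N arbitrary: f)
  case (Suc N)
  have m: "(\<lambda>x. \<phi> x * f x) \<in> schwartz_space" if "f \<in> schwartz_space" for f
    using assms(1) that by (simp add: schwartz_multipliers_def)
  have "(\<lambda>x. f x + \<phi> x * (\<phi> x * f x)) \<in> schwartz_space"
    by (intro schwartz_add m Suc.prems)
  from Suc.IH[OF this] show ?case by (simp add: algebra_simps power2_eq_square)
qed simp

text \<open>A point off the closure of the noncritical set can be moved, without changing the value
  of \<open>\<phi>\<close>, to the nearest point of that closure.\<close>
lemma range_subset_closure_noncritical:
  assumes \<phi>: "smooth \<phi>" and ne: "deriv \<phi> x\<^sub>0 \<noteq> 0"
  shows "range \<phi> \<subseteq> closure (\<phi> ` {x. deriv \<phi> x \<noteq> 0})"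
proof
  let ?D = "{x. deriv \<phi> x \<noteq> 0}"
  have cont: "continuous_on A \<phi>" for A using smooth_continuous[OF \<phi>, of A 0] by simp
  fix y assume "y \<in> range \<phi>"
  then obtain x where y: "y = \<phi> x" by blast
  have "closure ?D \<noteq> {}" using ne by auto
  from distance_attains_inf[OF closed_closure this, of x]
  obtain p where p: "p \<in> closure ?D" "\<And>z. z \<in> closure ?D \<Longrightarrow> dist x p \<le> dist x z" by blast
  have der: "(\<phi> has_real_derivative 0) (at z)" if "dist x z < dist x p" for z
  proof -
    have "z \<notin> ?D" using p(2)[of z] that closure_subset by force
    then show ?thesis using smooth_has_derivative[OF \<phi>, of 0 z] by simp
  qed
  have "\<phi> x = \<phi> p"
  proof (cases x p rule: linorder_cases)
    case less
    show ?thesis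
      by (rule DERIV_isconst_end[OF less cont der, symmetric]) (auto simp: dist_real_def)
  next
    case greater
    show ?thesis
      by (rule DERIV_isconst_end[OF greater cont der]) (auto simp: dist_real_def)
  qed simp
  moreover have "\<phi> ` closure ?D \<subseteq> closure (\<phi> ` ?D)"
    by (rule image_closure_subset[OF cont]) (auto intro: closure_subset[THEN subsetD])
  ultimately show "y \<in> closure (\<phi> ` ?D)" using p(1) y by auto
qed

lemma schwartz_symbol_unbounded:
  assumes "schwartz_symbol \<phi>"
  shows "\<not> bounded (range \<phi>)"
proof
  assume "bounded (range \<phi>)"
  then obtain M where M: "\<And>x. \<bar>\<phi> x\<bar> \<le> M" by (auto simp: bounded_iff)
  have "(\<lambda>x. x ^ 0 * exp (- (x\<^sup>2))) \<in> schwartz_space" by (rule schwartz_monomial_gauss)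
  from schwartz_symbol_comp[OF assms this]
  have S: "(\<lambda>x. exp (- (\<phi> x)\<^sup>2)) \<in> schwartz_space" by simp
  define B where "B = seminorm_real 1 (\<lambda>x. exp (- (\<phi> x)\<^sup>2))"
  define x where "x = 1 + B * exp (M\<^sup>2)"
  have "0 \<le> B" by (simp add: B_def seminorm_real_nonneg)
  then have "1 \<le> x" by (simp add: x_def)
  have "(\<phi> x)\<^sup>2 \<le> M\<^sup>2" using power_mono[OF M, of x 2] by simp
  then have "(1 + x\<^sup>2) * exp (- M\<^sup>2) \<le> (1 + x\<^sup>2) ^ 1 * \<bar>(deriv ^^ 0) (\<lambda>x. exp (- (\<phi> x)\<^sup>2)) x\<bar>"
    by (simp add: mult_left_mono)
  also have "\<dots> \<le> B" unfolding B_def by (rule seminorm_real_upper[OF S]) simp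
  finally have "1 + x\<^sup>2 \<le> B * exp (M\<^sup>2)" by (simp add: exp_minus field_simps)
  moreover have "x \<le> x\<^sup>2" using \<open>1 \<le> x\<close> by (simp add: power2_eq_square)
  ultimately show False by (simp add: x_def)
qed

lemma comp_bound_on_range:
  assumes mult: "\<phi> \<in> schwartz_multipliers" and symb: "schwartz_symbol \<phi>"
    and closed: "has_closed_range (mult_operator (deriv \<phi>))"
  shows "\<exists>C m. \<forall>f\<in>schwartz_space. \<forall>y\<in>closure (range \<phi>). \<forall>k\<le>N.
    (1 + y\<^sup>2) ^ N * \<bar>(deriv ^^ k) f y\<bar> \<le> C * seminorm_real m (\<lambda>x. f (\<phi> x))"
proof -
  have \<phi>: "smooth \<phi>" using symb by (simp add: schwartz_symbol_def)
  let ?D = "{x. deriv \<phi> x \<noteq> 0}"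
  have "\<exists>x. deriv \<phi> x \<noteq> 0"
  proof (rule ccontr)
    assume "\<not> ?thesis"
    then have "DERIV \<phi> x :> 0" for x using smooth_has_derivative[OF \<phi>, of 0 x] by simp
    then have "\<phi> x = \<phi> 0" for x using DERIV_isconst_all by blast
    then have "range \<phi> = {\<phi> 0}" by auto
    then show False using schwartz_symbol_unbounded[OF symb] by simp
  qed
  then have dense: "closure (range \<phi>) \<subseteq> closure (\<phi> ` ?D)"
    using range_subset_closure_noncritical[OF \<phi>] by (meson closed_closure closure_minimal)
  have "\<exists>C m. \<forall>f\<in>schwartz_space. \<forall>y\<in>closure (range \<phi>).
      (1 + y\<^sup>2) ^ N * \<bar>(deriv ^^ k) f y\<bar> \<le> C * seminorm_real m (\<lambda>x. f (\<phi> x))" for k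
  proof -
    from comp_higher_deriv_bound[of \<phi> "\<lambda>x. (1 + (\<phi> x)\<^sup>2) ^ N" 0 k,
      OF symb closed multiplier_weight[OF mult]]
    obtain C m where C: "\<And>f x. f \<in> schwartz_space \<Longrightarrow> deriv \<phi> x \<noteq> 0 \<Longrightarrow>
      (1 + (\<phi> x)\<^sup>2) ^ N * \<bar>(deriv ^^ k) f (\<phi> x)\<bar> \<le> C * seminorm_real m (\<lambda>x. f (\<phi> x))" by auto
    have "(1 + y\<^sup>2) ^ N * \<bar>(deriv ^^ k) f y\<bar> \<le> C * seminorm_real m (\<lambda>x. f (\<phi> x))"
      if f: "f \<in> schwartz_space" and y: "y \<in> closure (range \<phi>)" for f y
    proof -
      have "closed {y. (1 + y\<^sup>2) ^ N * \<bar>(deriv ^^ k) f y\<bar> \<le> C * seminorm_real m (\<lambda>x. f (\<phi> x))}"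
        by (intro closed_Collect_le continuous_intros smooth_continuous schwartz_smooth[OF f])
      then have "closure (\<phi> ` ?D) \<subseteq>
          {y. (1 + y\<^sup>2) ^ N * \<bar>(deriv ^^ k) f y\<bar> \<le> C * seminorm_real m (\<lambda>x. f (\<phi> x))}"
        using C[OF f] by (intro closure_minimal) auto
      then show ?thesis using dense y by blast
    qed
    then show ?thesis by blast
  qed
  then obtain C m where C: "\<And>k f y. f \<in> schwartz_space \<Longrightarrow> y \<in> closure (range \<phi>) \<Longrightarrow>
      (1 + y\<^sup>2) ^ N * \<bar>(deriv ^^ k) f y\<bar> \<le> C k * seminorm_real (m k) (\<lambda>x. f (\<phi> x))" by metis
  define M where "M = Max (m ` {..N})"
  have "(1 + y\<^sup>2) ^ N * \<bar>(deriv ^^ k) f y\<bar> \<le> (\<Sum>k\<le>N. \<bar>C k\<bar>) * seminorm_real M (\<lambda>x. f (\<phi> x))"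
    if "f \<in> schwartz_space" "y \<in> closure (range \<phi>)" "k \<le> N" for f y k
  proof (rule order_trans[OF C[OF that(1,2)]])
    have "m k \<le> M" unfolding M_def using that(3) by (intro Max_ge) auto
    have "C k \<le> \<bar>C k\<bar>" by simp
    also have "\<dots> \<le> (\<Sum>k\<le>N. \<bar>C k\<bar>)" using that(3) by (intro member_le_sum) auto
    finally show "C k * seminorm_real (m k) (\<lambda>x. f (\<phi> x)) \<le>
        (\<Sum>k\<le>N. \<bar>C k\<bar>) * seminorm_real M (\<lambda>x. f (\<phi> x))"
      by (intro mult_mono seminorm_real_mono schwartz_symbol_comp[OF symb] that(1) \<open>m k \<le> M\<close>
        sum_nonneg seminorm_real_nonneg) auto
  qed
  then show ?thesis by blast
qed

theorem proposition4p4: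
  fixes \<phi> :: "real \<Rightarrow> real"
  assumes "\<phi> \<in> schwartz_multipliers"
    and "schwartz_symbol \<phi>"
    and "has_closed_range (mult_operator (deriv \<phi>))"
  shows "has_closed_range (comp_operator \<phi>)"
  unfolding has_closed_range_def closedin_schwartz_topology_iff
proof (intro conjI ballI impI)
  note comp = schwartz_symbol_comp[OF assms(2)]
  show "comp_operator \<phi> ` schwartz_space \<subseteq> schwartz_space"
    using comp by (auto simp: comp_operator_def comp_def)
  fix g assume g: "g \<in> schwartz_space"
    and lim: "\<forall>n. \<forall>e>0. \<exists>r\<in>comp_operator \<phi> ` schwartz_space. seminorm_real n (\<lambda>x. r x - g x) < e"
  have "\<exists>f\<in>schwartz_space. seminorm_real n (\<lambda>x. f (\<phi> x) - g x) < (1/2) ^ n" for n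
    using lim[rule_format, of "(1/2) ^ n" n] by (auto simp: comp_operator_def)
  then obtain f where f: "\<And>n. f n \<in> schwartz_space"
    "\<And>n. seminorm_real n (\<lambda>x. f n (\<phi> x) - g x) < (1/2) ^ n" by metis
  define I where "I = closure (range \<phi>)"
  have cont: "continuous_on UNIV \<phi>"
    using smooth_continuous[of \<phi> UNIV 0] assms(2) by (simp add: schwartz_symbol_def)
  have I: "convex I" "closed I" "\<not> bounded I"
  proof -
    have "convex (range \<phi>)"
      using connected_continuous_image[OF cont connected_UNIV]
      by (simp only: is_interval_connected_1[symmetric] is_interval_convex_1[symmetric])
    then show "convex I" unfolding I_def by (rule convex_closure)
    show "\<not> bounded I"
      using schwartz_symbol_unbounded[OF assms(2)] bounded_subset closure_subset unfolding I_def by blast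
  qed (simp add: I_def)
  have cauchy: "\<exists>M. \<forall>a\<ge>M. \<forall>b\<ge>M. \<forall>y\<in>I. \<forall>j\<le>N.
      (1 + y\<^sup>2) ^ N * \<bar>(deriv ^^ j) (f a) y - (deriv ^^ j) (f b) y\<bar> \<le> e" if e: "0 < e" for N e
  proof -
    obtain C m where C: "\<And>f y k. f \<in> schwartz_space \<Longrightarrow> y \<in> I \<Longrightarrow> k \<le> N \<Longrightarrow>
       (1 + y\<^sup>2) ^ N * \<bar>(deriv ^^ k) f y\<bar> \<le> C * seminorm_real m (\<lambda>x. f (\<phi> x))"
      using comp_bound_on_range[OF assms, of N] unfolding I_def by blast
    obtain K where K: "(1/2::real) ^ K < e / (2 * (\<bar>C\<bar> + 1))"
      using real_arch_pow_inv[of "e / (2 * (\<bar>C\<bar> + 1))" "1/2"] e by auto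
    define M where "M = max K m"
    have near: "seminorm_real m (\<lambda>x. f a (\<phi> x) - g x) \<le> e / (2 * (\<bar>C\<bar> + 1))" if "a \<ge> M" for a
    proof -
      have "seminorm_real m (\<lambda>x. f a (\<phi> x) - g x) \<le> seminorm_real a (\<lambda>x. f a (\<phi> x) - g x)"
        using that by (intro seminorm_real_mono schwartz_diff comp f(1) g) (simp add: M_def)
      also have "\<dots> \<le> (1/2) ^ a" using f(2)[of a] by simp
      also have "\<dots> \<le> (1/2) ^ K" using that by (intro power_decreasing) (auto simp: M_def)
      finally show ?thesis using K by simp
    qed
    have "(1 + y\<^sup>2) ^ N * \<bar>(deriv ^^ j) (f a) y - (deriv ^^ j) (f b) y\<bar> \<le> e"
      if "a \<ge> M" "b \<ge> M" "y \<in> I" "j \<le> N" for a b y j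
    proof -
      have "(1 + y\<^sup>2) ^ N * \<bar>(deriv ^^ j) (f a) y - (deriv ^^ j) (f b) y\<bar> \<le>
          C * seminorm_real m (\<lambda>x. f a (\<phi> x) - f b (\<phi> x))"
        using C[OF schwartz_diff[OF f(1) f(1)] that(3,4), of a b]
        by (simp add: higher_deriv_diff[OF schwartz_smooth[OF f(1)] schwartz_smooth[OF f(1)]])
      also have "\<dots> \<le> (\<bar>C\<bar> + 1) * seminorm_real m (\<lambda>x. f a (\<phi> x) - f b (\<phi> x))"
        by (intro mult_right_mono seminorm_real_nonneg) simp
      also have "\<dots> \<le> (\<bar>C\<bar> + 1) * (e / (2 * (\<bar>C\<bar> + 1)) + e / (2 * (\<bar>C\<bar> + 1)))"
      proof (intro mult_left_mono)
        show "seminorm_real m (\<lambda>x. f a (\<phi> x) - f b (\<phi> x)) \<le> e / (2 * (\<bar>C\<bar> + 1)) + e / (2 * (\<bar>C\<bar> + 1))"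
          using seminorm_real_triangle[OF comp[OF f(1)] g comp[OF f(1)], of m a b]
            near[OF that(1)] near[OF that(2)] seminorm_real_minus_commute[OF g comp[OF f(1)], of m b]
          by linarith
      qed simp
      also have "\<dots> = e"
      proof -
        have "c * (e / (2 * c) + e / (2 * c)) = e" if "c \<noteq> 0" for c :: real
          using that by (simp add: field_simps)
        moreover have "\<bar>C\<bar> + 1 \<noteq> 0" by linarith
        ultimately show ?thesis by blast
      qed
      finally show ?thesis .
    qed
    then show ?thesis by blast
  qed
  obtain v where v: "schwartz_jet I v" "\<And>N e. 0 < e \<Longrightarrow> \<exists>M. \<forall>n\<ge>M. \<forall>x\<in>I. \<forall>j\<le>N.
      (1 + x\<^sup>2) ^ N * \<bar>(deriv ^^ j) (f n) x - v j x\<bar> \<le> e"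
    using schwartz_jet_limit[OF I(1) f(1) cauchy] by blast
  obtain h where h: "h \<in> schwartz_space" "\<And>y. y \<in> I \<Longrightarrow> h y = v 0 y"
    using schwartz_jet_extend[OF v(1) I] by blast
  have "g x = h (\<phi> x)" for x
  proof (rule LIMSEQ_unique)
    have "\<bar>f n (\<phi> x) - g x\<bar> \<le> (1/2) ^ n" for n
      using seminorm_real_abs[OF schwartz_diff[OF comp[OF f(1)] g], of 0 n n x] f(2)[of n] by simp
    then have "(\<lambda>n. f n (\<phi> x) - g x) \<longlonglongrightarrow> 0"
      by (intro Lim_null_comparison[OF _ LIMSEQ_power_zero[of "1/2::real"]]) auto
    then show "(\<lambda>n. f n (\<phi> x)) \<longlonglongrightarrow> g x" by (simp add: LIM_zero_iff)
    have "\<phi> x \<in> I" unfolding I_def by (rule closure_subset[THEN subsetD]) (rule rangeI)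
    show "(\<lambda>n. f n (\<phi> x)) \<longlonglongrightarrow> h (\<phi> x)"
    proof (rule LIMSEQ_I)
      fix e :: real assume "0 < e"
      from v(2)[OF half_gt_zero[OF this], of 0]
      obtain M where M: "\<forall>n\<ge>M. \<forall>y\<in>I. \<forall>j\<le>0. (1 + y\<^sup>2) ^ 0 * \<bar>(deriv ^^ j) (f n) y - v j y\<bar> \<le> e / 2" ..
      have "norm (f n (\<phi> x) - h (\<phi> x)) < e" if "n \<ge> M" for n
        using M[rule_format, OF that \<open>\<phi> x \<in> I\<close>, of 0] h(2)[OF \<open>\<phi> x \<in> I\<close>] \<open>0 < e\<close> by simp
      then show "\<exists>M. \<forall>n\<ge>M. norm (f n (\<phi> x) - h (\<phi> x)) < e" by blast
    qed
  qed
  then have "g = comp_operator \<phi> h" by (simp add: comp_operator_def fun_eq_iff)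
  with h(1) show "g \<in> comp_operator \<phi> ` schwartz_space" by blast
qed

end
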